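(* Let $\boldsymbol{\alpha}=(\alpha_1,\alpha_2,\alpha_3)\in\mathbb{R}^3$ be such that $1,\alpha_1,\alpha_2,\alpha_3$ are linearly independent over $\mathbb{Q}$, and suppose $\frac13<\hat{\omega}(\boldsymbol{\alpha})<1$. If $k(\boldsymbol{\alpha})=k$ is finite with $k\geqslant1$, then $$\frac{\omega(\boldsymbol{\alpha})}{\hat{\omega}(\boldsymbol{\alpha})}\geqslant \mathfrak{g}_k(\hat{\omega}(\boldsymbol{\alpha})).$$ If $k(\boldsymbol{\alpha})=\infty$, then $$\frac{\omega(\boldsymbol{\alpha})}{\hat{\omega}(\boldsymbol{\alpha})}\geqslant \overline{\mathfrak{g}}(\hat{\omega}(\boldsymbol{\alpha})).$$
   Context: Exponents: for $\boldsymbol{\alpha}\in\mathbb{R}^3$, $\omega(\boldsymbol{\alpha})$ is the supremum of $\gamma$ such that the system $\max_{1\le j\le 3}|q\alpha_j-a_j|\leqslant Q^{-\gamma}$, $1\leqslant q\leqslant Q$ has a solution $(q,a_1,a_2,a_3)\in\mathbb{Z}^4$ for arbitrarily large $Q$; $\hat{\omega}(\boldsymbol{\alpha})$ is the supremum of $\gamma$ such that this system has an integer solution for all sufficiently large $Q$. Best approximations: $|\cdot|$ is the Euclidean norm. The best approximation vectors of $\boldsymbol{\alpha}\notin\mathbb{Q}^3$ are the vectors $\mathbf{z}_\nu=(q_\nu,\mathbf{a}_\nu)\in\mathbb{Z}\times\mathbb{Z}^3$, $\nu\geqslant1$, with $1\le q_1<q_2<\cdots$, $\xi_\nu=|q_\nu\boldsymbol{\alpha}-\mathbf{a}_\nu|$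 strictly decreasing, and $\xi_\nu=\min\{|q\boldsymbol{\alpha}-\mathbf{a}|: q\in\mathbb{Z},\,1\le q\le q_\nu,\,\mathbf{a}\in\mathbb{Z}^3\}$; they form the complete sequence of such successive minimal points. Patterns: call an index $\nu$ good if $\mathbf{z}_{\nu-1},\mathbf{z}_\nu,\mathbf{z}_{\nu+1}$ are linearly independent in $\mathbb{R}^4$ (when $1,\alpha_1,\alpha_2,\alpha_3$ are linearly independent over $\mathbb{Q}$ there are infinitely many good indices). Let $\nu_1<\nu_2<\cdots$ be the good indices. For each $i\ge1$ let $C_i=A$ if the three-dimensional spaces $\langle\mathbf{z}_{\nu_i-1},\mathbf{z}_{\nu_i},\mathbf{z}_{\nu_i+1}\rangle_{\mathbb{R}}$ and $\langle\mathbf{z}_{\nu_{i+1}-1},\mathbf{z}_{\nu_{i+1}},\mathbf{z}_{\nu_{i+1}+1}\rangle_{\mathbb{R}}$ coincide, and $C_i=B$ otherwise. The word of $\boldsymbol{\alpha}$ is $\mathfrak{W}(\boldsymbol{\alpha})=C_1C_2C_3\ldots$. Define $k(\boldsymbol{\alpha})=\sup\{j\ge 0:\ \text{the subword } A^jB \text{ (}j\text{ letters }A\text{ followed by }B\text{) occurs infinitely many times in }\mathfrak{W}(\boldsymbol{\alpha})\}\in\mathbb{Z}_{\ge0}\cup\{\infty\}$. Parameters: for $\lambda\in(\frac13,1)$ put $\theta=\frac{1-\lambda}{\lambda}$, $S_k=\sum_{j=0}^{k-1}\theta^j$ ($S_0=0$), and for $k\ge1$: $M_k=\theta S_{k+1}$,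 $N_k=2\theta^k+\frac{S_k}{\lambda}+\theta S_{k-1}$, $P_k=\frac{S_{k-1}}{\lambda}+\theta^{k-1}$, $R_k(g,\lambda)=M_kg^2-N_kg+P_k$. $\mathfrak{g}_k(\lambda)$ denotes the unique root of $R_k(g,\lambda)=0$ in the interval $(1,\frac{2}{\theta})$. Finally $\overline{\mathfrak{g}}(\lambda)=\frac{1}{1-\lambda}$ if $\lambda\in[\frac12,1)$ and $\overline{\mathfrak{g}}(\lambda)=\frac{2}{\theta}$ if $\lambda\in(\frac13,\frac12]$ (this is $\lim_{k\to\infty}\mathfrak{g}_k(\lambda)$). *)

theory Defs
  imports "HOL-Analysis.Analysis" "HOL-Library.Extended_Nat" "HOL-Library.Infinite_Set"
begin

definition lin_indep_over_rat :: "real^3 \<Rightarrow> bool" where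
  "lin_indep_over_rat \<alpha> \<longleftrightarrow>
     (\<forall>(c0::rat) (c::rat^3). of_rat c0 * 1 + (\<Sum>j\<in>UNIV. of_rat (c $ j) * \<alpha> $ j) = 0
        \<longrightarrow> c0 = 0 \<and> (\<forall>j. c $ j = 0))"

subsection \<open>Exponents\<close>

definition approx_system :: "real^3 \<Rightarrow> real \<Rightarrow> real \<Rightarrow> bool" where
  "approx_system \<alpha> \<gamma> Q \<longleftrightarrow>
     (\<exists>(q::int) (a::int^3).
        (MAX j\<in>UNIV. \<bar>of_int q * \<alpha> $ j - of_int (a $ j)\<bar>) \<le> Q powr (- \<gamma>)
        \<and> 1 \<le> q \<and> of_int q \<le> Q)"

definition omega :: "real^3 \<Rightarrow> ereal" where
  "omega \<alpha> = (SUP \<gamma>\<in>{\<gamma>. \<exists>\<^sub>F Q in at_top. approx_system \<alpha> \<gamma> Q}. ereal \<gamma>)"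

definition omega_hat :: "real^3 \<Rightarrow> ereal" where
  "omega_hat \<alpha> = (SUP \<gamma>\<in>{\<gamma>. \<forall>\<^sub>F Q in at_top. approx_system \<alpha> \<gamma> Q}. ereal \<gamma>)"

subsection \<open>Best approximations\<close>

definition approx_dist :: "real^3 \<Rightarrow> int \<times> (int^3) \<Rightarrow> real" where
  "approx_dist \<alpha> z = norm (of_int (fst z) *\<^sub>R \<alpha> - (\<chi> j. of_int (snd z $ j)))"

text \<open>
  Sequences are indexed from \<open>1\<close>; the value at \<open>0\<close> is irrelevant. The last conjunct is
  completeness: no denominator of a successive minimal point is skipped. Together with the strict
  decrease of the distances it forces the smaller denominator whenever two different denominators
  realise the same minimal distance.
\<close>

definition best_approx_seq :: "real^3 \<Rightarrow> (nat \<Rightarrow> int \<times> (int^3)) \<Rightarrow> bool" where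
  "best_approx_seq \<alpha> z \<longleftrightarrow>
     1 \<le> fst (z 1) \<and>
     (\<forall>\<nu>\<ge>1. fst (z \<nu>) < fst (z (\<nu> + 1))) \<and>
     (\<forall>\<nu>\<ge>1. approx_dist \<alpha> (z (\<nu> + 1)) < approx_dist \<alpha> (z \<nu>)) \<and>
     (\<forall>\<nu>\<ge>1. \<forall>q a. 1 \<le> q \<and> q \<le> fst (z \<nu>) \<longrightarrow> approx_dist \<alpha> (z \<nu>) \<le> approx_dist \<alpha> (q, a)) \<and>
     (\<forall>q a. 1 \<le> q \<and>
        (\<forall>a'. approx_dist \<alpha> (q, a) \<le> approx_dist \<alpha> (q, a')) \<and>
        (\<forall>q' a'. 1 \<le> q' \<and> q' < q \<longrightarrow> approx_dist \<alpha> (q, a) < approx_dist \<alpha> (q', a'))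
        \<longrightarrow> (\<exists>\<nu>\<ge>1. fst (z \<nu>) = q))"

text \<open>
  If \<open>1, \<alpha>\<^sub>1, \<alpha>\<^sub>2, \<alpha>\<^sub>3\<close> are linearly independent over the rationals, such a sequence
  exists and is unique on the indices \<open>\<nu> \<ge> 1\<close>, so the choice below is immaterial.
\<close>

definition best_approx :: "real^3 \<Rightarrow> nat \<Rightarrow> int \<times> (int^3)" where
  "best_approx \<alpha> = (SOME z. best_approx_seq \<alpha> z)"

text \<open>Four-dimensional space is represented as \<open>real \<times> real^3\<close>.\<close>

definition best_vec :: "real^3 \<Rightarrow> nat \<Rightarrow> real \<times> (real^3)" where
  "best_vec \<alpha> \<nu> =
     (of_int (fst (best_approx \<alpha> \<nu>)), \<chi> j. of_int (snd (best_approx \<alpha> \<nu>) $ j))"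

subsection \<open>Patterns\<close>

definition best_triple :: "real^3 \<Rightarrow> nat \<Rightarrow> (real \<times> (real^3)) set" where
  "best_triple \<alpha> \<nu> = {best_vec \<alpha> (\<nu> - 1), best_vec \<alpha> \<nu>, best_vec \<alpha> (\<nu> + 1)}"

text \<open>
  The three vectors have strictly increasing first coordinates, hence are distinct, and
  independence of the set is independence of the family. The bound \<open>\<nu> \<ge> 2\<close> makes
  \<open>\<nu> - 1\<close> a legitimate index.
\<close>

definition good_indices :: "real^3 \<Rightarrow> nat set" where
  "good_indices \<alpha> = {\<nu>. 2 \<le> \<nu> \<and> independent (best_triple \<alpha> \<nu>)}"

datatype letter = Letter_A | Letter_B

text \<open>
  Good indices and letters are numbered from \<open>0\<close>: \<open>good_index \<alpha> i\<close> is \<open>\<nu>\<^sub>i\<^sub>+\<^sub>1\<close>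
  and \<open>pattern_word \<alpha> i\<close> is the letter \<open>C\<^sub>i\<^sub>+\<^sub>1\<close>.
\<close>

definition good_index :: "real^3 \<Rightarrow> nat \<Rightarrow> nat" where
  "good_index \<alpha> i = enumerate (good_indices \<alpha>) i"

definition pattern_word :: "real^3 \<Rightarrow> nat \<Rightarrow> letter" where
  "pattern_word \<alpha> i =
     (if span (best_triple \<alpha> (good_index \<alpha> i)) = span (best_triple \<alpha> (good_index \<alpha> (i + 1)))
      then Letter_A else Letter_B)"

definition AjB_occurs_at :: "(nat \<Rightarrow> letter) \<Rightarrow> nat \<Rightarrow> nat \<Rightarrow> bool" where
  "AjB_occurs_at W j i \<longleftrightarrow> (\<forall>m<j. W (i + m) = Letter_A) \<and> W (i + j) = Letter_B"

definition pattern_k :: "real^3 \<Rightarrow> enat" where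
  "pattern_k \<alpha> = (SUP j\<in>{j. infinite {i. AjB_occurs_at (pattern_word \<alpha>) j i}}. enat j)"

subsection \<open>Parameters\<close>

definition theta :: "real \<Rightarrow> real" where
  "theta l = (1 - l) / l"

definition S_sum :: "nat \<Rightarrow> real \<Rightarrow> real" where
  "S_sum k l = (\<Sum>j<k. theta l ^ j)"

definition M_coeff :: "nat \<Rightarrow> real \<Rightarrow> real" where
  "M_coeff k l = theta l * S_sum (k + 1) l"

definition N_coeff :: "nat \<Rightarrow> real \<Rightarrow> real" where
  "N_coeff k l = 2 * theta l ^ k + S_sum k l / l + theta l * S_sum (k - 1) l"

definition P_coeff :: "nat \<Rightarrow> real \<Rightarrow> real" where
  "P_coeff k l = S_sum (k - 1) l / l + theta l ^ (k - 1)"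

definition R_poly :: "nat \<Rightarrow> real \<Rightarrow> real \<Rightarrow> real" where
  "R_poly k g l = M_coeff k l * g\<^sup>2 - N_coeff k l * g + P_coeff k l"

text \<open>
  For \<open>1/3 < l < 1\<close> and \<open>k \<ge> 1\<close> the root is unique: the leading coefficient is positive, and with
  \<open>t = theta l\<close> the values at \<open>1\<close> and \<open>2 / t\<close> are \<open>t ^ k * (t - 2) < 0\<close> and \<open>(2 - t) / t > 0\<close>.
\<close>

definition g_root :: "nat \<Rightarrow> real \<Rightarrow> real" where
  "g_root k l = (THE g. 1 < g \<and> g < 2 / theta l \<and> R_poly k g l = 0)"

definition g_bar :: "real \<Rightarrow> real" where
  "g_bar l = (if 1 / 2 \<le> l then 1 / (1 - l) else 2 / theta l)"

end

theory Submission
  imports Defs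
begin

text \<open>
  Suppose that \<open>A\<^sup>kB\<close> occurs, let \<open>n\<^sub>0 < \<dots> < n\<^sub>k\<^sub>+\<^sub>1\<close> be the good indices involved, let \<open>\<Lambda>\<close> be
  the hyperplane shared by the first \<open>k + 1\<close> triples, and let \<open>(c, b)\<close> be an integral normal of
  \<open>\<Lambda>\<close> with \<open>|b|\<close> minimal. Exterior products of three best approximations in \<open>\<Lambda>\<close> are again integral
  normals, so \<open>|b|\<close> is at most a constant times \<open>q\<^sub>t \<xi>\<^sub>r \<xi>\<^sub>s\<close> for independent \<open>z\<^sub>r, z\<^sub>s, z\<^sub>t\<close> in \<open>\<Lambda>\<close>, \<open>r < s < t\<close>.
  This is used for \<open>(n\<^sub>0 - 1, n\<^sub>0, n\<^sub>0 + 1)\<close> and for \<open>(n\<^sub>j - 1, n\<^sub>j\<^sub>+\<^sub>1 - 1, n\<^sub>j\<^sub>+\<^sub>1)\<close>. Conversely, with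
  \<open>m = n\<^sub>k\<^sub>+\<^sub>1\<close>, the normal kills \<open>z\<^sub>m\<close> but not \<open>z\<^sub>m\<^sub>+\<^sub>1\<close>, whence \<open>1 \<le> 2 |b| \<xi>\<^sub>m q\<^sub>m\<^sub>+\<^sub>1 / q\<^sub>m\<close>.
  Put \<open>g = \<omega> / \<lambda>\<close>, \<open>h = \<theta> g\<close>, \<open>X\<^sub>j = ln q\<close> at \<open>n\<^sub>j\<close> and \<open>E = (ln |b|) / \<lambda>\<close>. Up to bounded errors, the
  estimates \<open>\<xi>\<^sub>\<nu> \<le> q\<^sub>\<nu>\<^sub>+\<^sub>1 powr (-\<lambda>)\<close> and \<open>q\<^sub>\<nu>\<^sub>+\<^sub>1 \<le> q\<^sub>\<nu> powr g\<close> turn the three bounds into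
  \<open>E \<le> (h - 1) X\<^sub>0\<close>, \<open>X\<^sub>j + E \<le> \<theta> X\<^sub>j\<^sub>+\<^sub>1\<close> and \<open>(1 + \<theta> - h) X\<^sub>k\<^sub>+\<^sub>1 \<le> E\<close>. Eliminating \<open>E\<close> and the \<open>X\<^sub>j\<close>
  leaves exactly \<open>R\<^sub>k(g, \<lambda>) \<ge> 0\<close>. The case of infinite \<open>k\<close> follows by letting \<open>k\<close> grow.
\<close>

subsection \<open>The polynomials \<open>R\<^sub>k\<close>\<close>

lemma S_sum_Suc: "S_sum (Suc k) l = S_sum k l + theta l ^ k"
  by (simp add: S_sum_def)

lemma S_sum_Suc_shift: "S_sum (Suc k) l = 1 + theta l * S_sum k l"
  by (simp only: S_sum_def sum.lessThan_Suc_shift) (simp add: sum_distrib_left)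

lemma S_sum_geometric: "(theta l - 1) * S_sum k l = theta l ^ k - 1"
  by (induction k) (simp_all add: S_sum_Suc S_sum_def algebra_simps)

lemma theta_pos: "0 < l \<Longrightarrow> l < 1 \<Longrightarrow> 0 < theta l"
  by (simp add: theta_def)

lemma inverse_eq_1_plus_theta: "0 < l \<Longrightarrow> 1 / l = 1 + theta l"
  by (simp add: theta_def field_simps)

lemma S_sum_ge_1: "0 < l \<Longrightarrow> l < 1 \<Longrightarrow> 1 \<le> S_sum (Suc k) l"
  unfolding S_sum_Suc_shift using theta_pos[of l]
  by (simp add: S_sum_def sum_nonneg)

text \<open>In terms of \<open>theta l * g\<close> the polynomial becomes compact, since
  \<open>S_sum_geometric\<close> trades powers of \<theta> for one partial sum. This form shows what
  unbounded sums force when \<theta> \<ge> 1.\<close>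

lemma theta_mult_R_poly:
  assumes "0 < l" "1 \<le> k"
  shows "theta l * R_poly k g l
    = (theta l * g - 1) * (2 - S_sum (Suc k) l * (2 - theta l * g)) - theta l"
proof -
  obtain m where m: "k = Suc m" using assms(2) by (cases k) auto
  define t where "t = theta l"
  define s where "s = S_sum m l"
  have geo: "t ^ m = 1 + (t - 1) * s"
    using S_sum_geometric[of l m] by (simp add: t_def s_def)
  have il: "inverse l = 1 + t"
    using inverse_eq_1_plus_theta[OF assms(1)] by (simp add: t_def inverse_eq_divide)
  have S1: "S_sum (Suc m) l = 1 + t * s" "S_sum (Suc (Suc m)) l = 1 + t * (1 + t * s)"
    by (simp_all add: S_sum_Suc_shift t_def s_def)
  show ?thesis
    unfolding R_poly_def M_coeff_def N_coeff_def P_coeff_def m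
    by (simp add: S1 geo divide_inverse il flip: t_def s_def) (simp add: algebra_simps power2_eq_square)
qed

text \<open>The form in which the elimination at the end delivers \<open>R_poly\<close>. Its
  isolated power of \<theta> also makes it the right form for large \<open>k\<close> when \<theta> <
  1.\<close>

lemma theta_mult_R_poly':
  assumes "0 < l" "1 \<le> k"
  shows "theta l * R_poly k g l
    = (theta l * g - 1) * theta l ^ Suc k
      - (1 + theta l - theta l * g) * (1 + (theta l * g - 1) * S_sum (Suc k) l)"
proof -
  have p: "theta l ^ Suc k = 1 + (theta l - 1) * S_sum (Suc k) l"
    using S_sum_geometric[of l "Suc k"] by linarith
  show ?thesis
    unfolding theta_mult_R_poly[OF assms] p by (simp add: algebra_simps)
qed

lemma R_poly_at_1_neg:
  assumes "1 / 3 < l" "l < 1" "1 \<le> k"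
  shows "R_poly k 1 l < 0"
proof -
  have t: "0 < theta l" "theta l < 2"
    using assms by (auto simp: theta_def field_simps)
  have p: "theta l ^ Suc k = 1 + (theta l - 1) * S_sum (Suc k) l"
    using S_sum_geometric[of l "Suc k"] by linarith
  have "theta l * R_poly k 1 l = theta l ^ Suc k * (theta l - 2)"
    unfolding p by (subst theta_mult_R_poly) (use assms in \<open>auto simp: algebra_simps\<close>)
  then have "theta l * R_poly k 1 l = theta l * (theta l ^ k * (theta l - 2))"
    by simp
  then have "R_poly k 1 l = theta l ^ k * (theta l - 2)" using t by simp
  then show ?thesis using t by (simp add: mult_pos_neg)
qed

lemma R_poly_at_2_over_theta_pos:
  assumes "1 / 3 < l" "l < 1" "1 \<le> k"
  shows "0 < R_poly k (2 / theta l) l"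
proof -
  have t: "0 < theta l" "theta l < 2"
    using assms by (auto simp: theta_def field_simps)
  have "theta l * R_poly k (2 / theta l) l = 2 - theta l"
    by (subst theta_mult_R_poly) (use assms t in auto)
  then show ?thesis using t by (metis diff_gt_0_iff_gt zero_less_mult_pos)
qed

lemma M_coeff_pos: "0 < l \<Longrightarrow> l < 1 \<Longrightarrow> 0 < M_coeff k l"
  using S_sum_ge_1[of l k] theta_pos[of l] by (simp add: M_coeff_def)

text \<open>The leading coefficient is positive and the value at 1 is negative, so the root other
  than \<open>r\<close> lies below 1. In the factorisation by \<open>x - r\<close> the linear
  cofactor is therefore positive from 1 onwards.\<close>

lemma R_poly_neg_below_root:
  assumes "1 / 3 < l" "l < 1" "1 \<le> k" "R_poly k r l = 0" "1 \<le> g" "g < r"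
  shows "R_poly k g l < 0"
proof -
  define M where "M = M_coeff k l"
  have M: "0 < M" unfolding M_def using assms by (intro M_coeff_pos) auto
  define N where "N = N_coeff k l"
  define P where "P = P_coeff k l"
  have P: "P = N * r - M * r\<^sup>2"
    using assms(4) by (simp add: R_poly_def M_def N_def P_def)
  have R: "R_poly k x l = (x - r) * (M * (x + r) - N)" for x
    by (simp add: R_poly_def P power2_eq_square algebra_simps flip: M_def N_def P_def)
  have "R_poly k 1 l < 0" using R_poly_at_1_neg assms by blast
  then have "0 < M * (1 + r) - N" using assms(5,6) by (simp add: R mult_less_0_iff)
  also have "\<dots> \<le> M * (g + r) - N" using M assms(5) by simp
  finally show ?thesis using assms(6) by (simp add: R mult_neg_pos)
qed

text \<open>The definite description is settled here: the intermediate value theorem gives a root,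
  and of two different roots the smaller would have a negative value. The same sign argument
  excludes \<open>g\<close> to the left of the root.\<close>

lemma g_root_le:
  assumes "1 / 3 < l" "l < 1" "1 \<le> k" "1 \<le> g" "0 \<le> R_poly k g l"
  shows "g_root k l \<le> g"
proof -
  let ?P = "\<lambda>r. 1 < r \<and> r < 2 / theta l \<and> R_poly k r l = 0"
  have t: "0 < theta l" "theta l < 2"
    using assms by (auto simp: theta_def field_simps)
  have c: "continuous_on {1..2 / theta l} (\<lambda>x. R_poly k x l)"
    unfolding R_poly_def by (intro continuous_intros)
  note n = R_poly_at_1_neg[OF assms(1-3)] and p = R_poly_at_2_over_theta_pos[OF assms(1-3)]
  obtain r where "1 \<le> r" "r \<le> 2 / theta l" "R_poly k r l = 0"
    using IVT'[OF _ _ _ c, of 0] n p t by (auto simp: field_simps)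
  with n p have r: "?P r" by (metis less_eq_real_def less_irrefl)
  have uniq: "r' = r" if "?P r'" for r'
  proof (rule ccontr)
    assume "r' \<noteq> r"
    then show False
      using R_poly_neg_below_root[OF assms(1-3), of r r'] R_poly_neg_below_root[OF assms(1-3), of r' r]
        r that by (cases r' r rule: linorder_cases) auto
  qed
  have "g_root k l = r" unfolding g_root_def using r uniq by (rule the_equality)
  moreover have "r \<le> g"
    using R_poly_neg_below_root[OF assms(1-3), of r g] r assms(4,5) by force
  ultimately show ?thesis by simp
qed

text \<open>Put \<open>u = theta l * g - 1\<close>. If \<theta> < 1, the powers of \<theta> die out
  and force \<open>theta l \<le> u\<close>; if \<theta> \<ge> 1, the sums
  \<open>S_sum (Suc k) l\<close> are unbounded and force \<open>1 \<le> u\<close>. These are the two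
  branches of \<open>g_bar\<close>.\<close>

lemma g_bar_le:
  assumes "1 / 3 < l" "l < 1" "1 \<le> theta l * g"
    and R: "\<And>K. \<exists>k\<ge>K. 1 \<le> k \<and> 0 \<le> R_poly k g l"
  shows "g_bar l \<le> g"
proof -
  define t where "t = theta l"
  define u where "u = t * g - 1"
  have t: "0 < t" using assms by (simp add: t_def theta_pos)
  have u: "0 \<le> u" using assms(3) by (simp add: u_def t_def)
  have il: "1 / (1 - l) = (1 + t) / t" using assms by (simp add: t_def theta_def field_simps)
  show ?thesis
  proof (cases "t < 1")
    case True
    have "t \<le> u"
    proof (rule ccontr)
      assume "\<not> t \<le> u"
      have "(\<lambda>k. u * t ^ Suc k) \<longlonglongrightarrow> u * 0"
        by (intro tendsto_mult tendsto_const LIMSEQ_Suc LIMSEQ_realpow_zero) (use t True in auto)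
      then have "\<forall>\<^sub>F k in sequentially. u * t ^ Suc k < t - u"
        by (rule order_tendstoD) (use \<open>\<not> t \<le> u\<close> in simp)
      then obtain K where K: "\<And>k. k \<ge> K \<Longrightarrow> u * t ^ Suc k < t - u"
        by (auto simp: eventually_sequentially)
      obtain k where k: "k \<ge> K" "1 \<le> k" "0 \<le> R_poly k g l" using R by blast
      have "0 \<le> theta l * R_poly k g l" using k t by (simp add: t_def)
      then have "(t - u) * (1 + u * S_sum (Suc k) l) \<le> u * t ^ Suc k"
        using k assms by (subst (asm) theta_mult_R_poly') (auto simp: u_def t_def algebra_simps)
      moreover have "(t - u) * 1 \<le> (t - u) * (1 + u * S_sum (Suc k) l)"
        using \<open>\<not> t \<le> u\<close> u S_sum_ge_1[of l k] assms by (intro mult_left_mono) auto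
      ultimately have "t - u \<le> u * t ^ Suc k" by (metis order_trans mult_1_right)
      then show False using K[OF k(1)] by (meson not_le)
    qed
    moreover have "1 / 2 \<le> l" using True assms by (simp add: t_def theta_def field_simps)
    ultimately show ?thesis using t by (simp add: g_bar_def il u_def field_simps)
  next
    case False
    have "1 \<le> u"
    proof (rule ccontr)
      assume u1: "\<not> 1 \<le> u"
      obtain K where K: "2 / (1 - u) < of_nat K" using reals_Archimedean2 by blast
      obtain k where k: "k \<ge> K" "1 \<le> k" "0 \<le> R_poly k g l" using R by blast
      have "0 \<le> theta l * R_poly k g l" using k t by (simp add: t_def)
      then have le: "t \<le> u * (2 - S_sum (Suc k) l * (1 - u))"
        using k assms by (subst (asm) theta_mult_R_poly) (auto simp: u_def t_def algebra_simps)
      have "2 < S_sum (Suc k) l * (1 - u)"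
      proof -
        have "(\<Sum>j<Suc k. 1) \<le> S_sum (Suc k) l"
          unfolding S_sum_def by (intro sum_mono) (use False in \<open>simp add: t_def\<close>)
        then have "real K < S_sum (Suc k) l" using k(1) by simp
        then have "real K * (1 - u) < S_sum (Suc k) l * (1 - u)" using u1 by simp
        moreover have "2 < real K * (1 - u)" using K u1 by (simp add: pos_divide_less_eq)
        ultimately show ?thesis by linarith
      qed
      then have "u * (2 - S_sum (Suc k) l * (1 - u)) \<le> 0"
        using u by (intro mult_nonneg_nonpos) auto
      then show False using t le by linarith
    qed
    \<comment> \<open>The case \<open>t = 1\<close> falls under the first branch of
      \<open>g_bar\<close>, where both branches agree.\<close>
    moreover have "l = 1 / 2" if "1 / 2 \<le> l"
      using that False assms by (simp add: t_def theta_def field_simps)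
    moreover have "2 / t \<le> g" if "1 \<le> u" using t that by (simp add: u_def field_simps)
    ultimately have "2 / t \<le> g" "1 / 2 \<le> l \<longrightarrow> l = 1 / 2" by auto
    moreover have "1 / (1 - l) = 2 / t" if "l = 1 / 2" unfolding t_def theta_def that by simp
    ultimately show ?thesis unfolding g_bar_def t_def[symmetric] by metis
  qed
qed

subsection \<open>Integral normals of three-dimensional subspaces\<close>

unbundle cross3_syntax

definition integral_point :: "real \<times> (real^3) \<Rightarrow> bool" where
  "integral_point v \<longleftrightarrow> fst v \<in> \<int> \<and> (\<forall>i. snd v $ i \<in> \<int>)"

text \<open>The generalised cross product in four dimensions: \<open>wedge u v w \<bullet> t\<close>
  is the determinant with rows \<open>u\<close>, \<open>v\<close>, \<open>w\<close>,
  \<open>t\<close>.\<close>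

definition wedge :: "real \<times> (real^3) \<Rightarrow> real \<times> (real^3) \<Rightarrow> real \<times> (real^3) \<Rightarrow> real \<times> (real^3)" where
  "wedge u v w = (- (snd u \<bullet> (snd v \<times> snd w)),
     fst u *\<^sub>R (snd v \<times> snd w) + fst v *\<^sub>R (snd w \<times> snd u) + fst w *\<^sub>R (snd u \<times> snd v))"

definition offset :: "real^3 \<Rightarrow> real \<times> (real^3) \<Rightarrow> real^3" where
  "offset \<alpha> v = fst v *\<^sub>R \<alpha> - snd v"

lemma wedge_orthogonal: "t \<in> {u, v, w} \<Longrightarrow> wedge u v w \<bullet> t = 0"
  by (cases u; cases v; cases w) (auto simp: wedge_def cross3_simps)

lemma integral_point_wedge:
  "integral_point u \<Longrightarrow> integral_point v \<Longrightarrow> integral_point w \<Longrightarrow> integral_point (wedge u v w)"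
  unfolding integral_point_def wedge_def
  by (auto simp: inner_vec_def sum_3 cross_components forall_3 intro!: Ints_add Ints_mult Ints_diff Ints_minus)

lemma norm_cross_le: "norm (x \<times> y) \<le> norm x * norm y" for x y :: "real^3"
proof (rule power2_le_imp_le)
  show "(norm (x \<times> y))\<^sup>2 \<le> (norm x * norm y)\<^sup>2"
    using norm_cross_dot[of x y] by (simp flip: norm_cross_dot)
qed simp

text \<open>After substituting \<open>snd x = fst x *\<^sub>R \<alpha> - offset \<alpha> x\<close>
  every term containing \<alpha> cancels. Each remaining term carries two error vectors, which keeps
  it small.\<close>

lemma snd_wedge_offset:
  "snd (wedge u v w) = fst u *\<^sub>R (offset \<alpha> v \<times> offset \<alpha> w)
     + fst v *\<^sub>R (offset \<alpha> w \<times> offset \<alpha> u) + fst w *\<^sub>R (offset \<alpha> u \<times> offset \<alpha> v)"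
  by (cases u; cases v; cases w) (simp add: wedge_def offset_def cross3_simps forall_3)

lemma norm_snd_wedge_le:
  assumes "0 \<le> fst u" "fst u \<le> fst w" "0 \<le> fst v" "fst v \<le> fst w"
    and "norm (offset \<alpha> w) \<le> norm (offset \<alpha> u)" "norm (offset \<alpha> w) \<le> norm (offset \<alpha> v)"
  shows "norm (snd (wedge u v w)) \<le> 3 * (fst w * norm (offset \<alpha> u) * norm (offset \<alpha> v))"
proof -
  let ?n = "\<lambda>x. norm (offset \<alpha> x)"
  have *: "norm (c *\<^sub>R (offset \<alpha> x \<times> offset \<alpha> y)) \<le> fst w * (?n u * ?n v)"
    if "0 \<le> c" "c \<le> fst w" "?n x * ?n y \<le> ?n u * ?n v" for c x y
  proof -
    have "norm (c *\<^sub>R (offset \<alpha> x \<times> offset \<alpha> y)) \<le> c * (?n x * ?n y)"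
      using that(1) norm_cross_le by (simp add: mult_left_mono)
    also have "\<dots> \<le> fst w * (?n u * ?n v)" by (rule mult_mono) (use that in auto)
    finally show ?thesis .
  qed
  have "?n v * ?n w \<le> ?n u * ?n v" "?n w * ?n u \<le> ?n u * ?n v"
    using mult_left_mono[OF assms(5), of "?n v"] mult_left_mono[OF assms(6), of "?n u"]
    by (simp_all add: mult.commute)
  then have "norm (snd (wedge u v w)) \<le> fst w * (?n u * ?n v) + fst w * (?n u * ?n v) + fst w * (?n u * ?n v)"
    unfolding snd_wedge_offset[of _ _ _ \<alpha>]
    by (intro norm_triangle_le add_mono *) (use assms in auto)
  then show ?thesis by simp
qed

text \<open>Multiples of \<open>u\<close> clear the first coordinates of \<open>v\<close> and
  \<open>w\<close>. The cross product of what is left is a multiple of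
  \<open>snd (wedge u v w)\<close>, so its vanishing would mean collinearity and hence a dependent
  triple.\<close>

lemma snd_wedge_nonzero:
  assumes "independent {u, v, w}" "u \<noteq> v" "u \<noteq> w" "v \<noteq> w" "fst u \<noteq> 0"
  shows "snd (wedge u v w) \<noteq> 0"
proof
  assume 0: "snd (wedge u v w) = 0"
  define v' where "v' = fst u *\<^sub>R v - fst v *\<^sub>R u"
  define w' where "w' = fst u *\<^sub>R w - fst w *\<^sub>R u"
  have "snd v' \<times> snd w' = fst u *\<^sub>R snd (wedge u v w)"
    by (cases u; cases v; cases w) (simp add: wedge_def v'_def w'_def cross3_simps forall_3)
  then have "snd v' \<times> snd w' = 0" using 0 by simp
  then have "snd v' = 0 \<or> snd w' = 0 \<or> (\<exists>c. snd w' = c *\<^sub>R snd v')"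
    by (simp add: cross_eq_0 collinear_lemma)
  moreover have f: "fst v' = 0" "fst w' = 0" by (simp_all add: v'_def w'_def)
  ultimately have "v' = 0 \<or> (\<exists>c. w' = c *\<^sub>R v')"
    by (auto simp: prod_eq_iff intro: exI[of _ 0])
  moreover have "v' \<noteq> 0"
  proof
    assume "v' = 0"
    then have "v = (fst v / fst u) *\<^sub>R u"
      using assms(5) by (simp add: v'_def eq_vector_fraction_iff)
    then have "v \<in> span {u, w}" by (metis insertI1 span_base span_scale)
    moreover have "independent (insert v {u, w})" using assms(1) by (simp add: insert_commute)
    ultimately show False using assms(2,4) by (simp add: independent_insert split: if_splits)
  qed
  moreover have False if "w' = c *\<^sub>R v'" for c
  proof -
    have "fst u *\<^sub>R w = fst w *\<^sub>R u + c *\<^sub>R (fst u *\<^sub>R v - fst v *\<^sub>R u)"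
      using that by (simp add: v'_def w'_def algebra_simps)
    also have "\<dots> \<in> span {u, v}"
      by (intro span_add span_diff span_scale) (auto intro: span_base)
    finally have "(1 / fst u) *\<^sub>R (fst u *\<^sub>R w) \<in> span {u, v}" by (rule span_scale)
    then have "w \<in> span {u, v}" using assms(5) by simp
    moreover have "independent (insert w {u, v})" using assms(1) by (simp add: insert_commute)
    ultimately show False using assms(3,4) by (simp add: independent_insert split: if_splits)
  qed
  ultimately show False by blast
qed

text \<open>Length is measured on \<open>snd p\<close>, the part that
  \<open>norm_snd_wedge_le\<close> controls; hence the condition
  \<open>snd p \<noteq> 0\<close>.\<close>

definition integral_normals :: "(real \<times> (real^3)) set \<Rightarrow> (real \<times> (real^3)) set" where
  "integral_normals S = {p. integral_point p \<and> snd p \<noteq> 0 \<and> (\<forall>t\<in>S. p \<bullet> t = 0)}"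

lemma norm_sq_integral_point:
  assumes "integral_point p"
  shows "\<exists>n::nat. (norm (snd p))\<^sup>2 = real n"
proof -
  have "(norm (snd p))\<^sup>2 \<in> \<int>"
    using assms unfolding power2_norm_eq_inner inner_vec_def integral_point_def by auto
  then have "(norm (snd p))\<^sup>2 \<in> \<nat>" by (simp add: Nats_altdef2)
  then show ?thesis by (auto elim: Nats_cases)
qed

lemma norm_integral_normal_ge_1:
  assumes "p \<in> integral_normals S"
  shows "1 \<le> norm (snd p)"
proof -
  obtain n where n: "(norm (snd p))\<^sup>2 = real n"
    using norm_sq_integral_point[of p] assms by (auto simp: integral_normals_def)
  have "snd p \<noteq> 0" using assms by (simp add: integral_normals_def)
  then have "n \<noteq> 0" using n by (metis norm_eq_zero of_nat_0 zero_eq_power2)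
  then have "1\<^sup>2 \<le> (norm (snd p))\<^sup>2" using n by simp
  then show ?thesis by (rule power2_le_imp_le) simp
qed

text \<open>Squared lengths are natural numbers, so a least one exists.\<close>

lemma minimal_integral_normal:
  assumes "p0 \<in> integral_normals S"
  obtains p where "p \<in> integral_normals S"
    "\<And>p'. p' \<in> integral_normals S \<Longrightarrow> norm (snd p) \<le> norm (snd p')"
proof -
  define m :: "real \<times> (real^3) \<Rightarrow> nat" where "m p = nat \<lfloor>(norm (snd p))\<^sup>2\<rfloor>" for p
  have m: "(norm (snd p))\<^sup>2 = real (m p)" if "p \<in> integral_normals S" for p
    using norm_sq_integral_point[of p] that by (auto simp: m_def integral_normals_def)
  obtain p where p: "p \<in> integral_normals S" "\<And>p'. p' \<in> integral_normals S \<Longrightarrow> m p \<le> m p'"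
    using ex_has_least_nat[of "\<lambda>p. p \<in> integral_normals S" p0 m] assms by blast
  show ?thesis
  proof (rule that[OF p(1)])
    fix p' assume p': "p' \<in> integral_normals S"
    have "(norm (snd p))\<^sup>2 \<le> (norm (snd p'))\<^sup>2"
      unfolding m[OF p(1)] m[OF p'] using p(2)[OF p'] by simp
    then show "norm (snd p) \<le> norm (snd p')" by (rule power2_le_imp_le) simp
  qed
qed

text \<open>Lets normals built from later triples compete with those of the first triple while the
  hyperplane stays the same.\<close>

lemma integral_normals_cong_span:
  assumes "span S = span T"
  shows "integral_normals S = integral_normals T"
proof -
  have *: "(\<forall>t\<in>S. p \<bullet> t = 0) \<longleftrightarrow> (\<forall>t\<in>span S. p \<bullet> t = 0)" for S and p :: "real \<times> (real^3)"
  proof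
    assume "\<forall>t\<in>S. p \<bullet> t = 0"
    then have "span S \<subseteq> {x. p \<bullet> x = 0}" by (intro span_minimal subspace_hyperplane) auto
    then show "\<forall>t\<in>span S. p \<bullet> t = 0" by auto
  qed (auto intro: span_base)
  show ?thesis unfolding integral_normals_def *[of S] *[of T] assms ..
qed

lemma span_eq_hyperplane:
  fixes S :: "(real \<times> (real^3)) set"
  assumes "independent S" "card S = 3" "p \<in> integral_normals S"
  shows "span S = {x. p \<bullet> x = 0}"
proof -
  have p: "p \<noteq> 0" using assms(3) by (auto simp: integral_normals_def)
  have "span S \<subseteq> {x. p \<bullet> x = 0}"
    using assms(3) by (intro span_minimal subspace_hyperplane) (auto simp: integral_normals_def)
  moreover have "dim {x. p \<bullet> x = 0} \<le> dim (span S)"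
    using dim_hyperplane[OF p] dim_eq_card_independent[OF assms(1)] assms(2) by simp
  ultimately show ?thesis
    by (intro subspace_dim_equal subspace_span subspace_hyperplane)
qed

subsection \<open>Best approximations\<close>

lemma approx_dist_round_le:
  "approx_dist \<alpha> (q, \<chi> j. round (of_int q * \<alpha> $ j)) \<le> approx_dist \<alpha> (q, a)"
  unfolding approx_dist_def
  by (intro norm_le_componentwise_cart) (simp add: round_diff_minimal)

lemma approx_dist_pos:
  assumes "lin_indep_over_rat \<alpha>" "1 \<le> q"
  shows "0 < approx_dist \<alpha> (q, a)"
proof (rule ccontr)
  assume "\<not> 0 < approx_dist \<alpha> (q, a)"
  then have "of_int q *\<^sub>R \<alpha> - (\<chi> j. of_int (a $ j)) = 0"
    by (simp add: approx_dist_def)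
  then have "(of_int q *\<^sub>R \<alpha> - (\<chi> j. of_int (a $ j))) $ 1 = 0" by simp
  then have eq: "of_int q * \<alpha> $ 1 = of_int (a $ 1)" by simp
  \<comment> \<open>An exact first coordinate is already a rational relation between 1 and
    \<open>\<alpha> $ 1\<close>.\<close>
  define c :: "rat^3" where "c = (\<chi> j. if j = 1 then of_int q else 0)"
  have "of_rat (of_int (- (a $ 1))) * 1 + (\<Sum>j\<in>UNIV. of_rat (c $ j) * \<alpha> $ j) = 0"
    using eq by (simp add: c_def sum_3 of_rat_minus)
  then have "c $ 1 = 0" using assms(1) unfolding lin_indep_over_rat_def by blast
  then show False using assms(2) by (simp add: c_def)
qed

text \<open>The exponents use the maximum norm and best approximations the Euclidean norm; passing
  through the sum norm of three coordinates costs the factor 3.\<close>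

lemma approx_system_imp_approx_dist:
  assumes "approx_system \<alpha> \<gamma> Q"
  obtains q a where "1 \<le> q" "of_int q \<le> Q" "approx_dist \<alpha> (q, a) \<le> 3 * Q powr (- \<gamma>)"
proof -
  obtain q a where qa: "(MAX j\<in>UNIV. \<bar>of_int q * \<alpha> $ j - of_int (a $ j)\<bar>) \<le> Q powr (- \<gamma>)"
    "1 \<le> q" "of_int q \<le> Q"
    using assms by (auto simp: approx_system_def)
  have c: "\<bar>of_int q * \<alpha> $ j - of_int (a $ j)\<bar> \<le> Q powr (- \<gamma>)" for j
    by (rule order_trans[OF _ qa(1)]) (auto intro!: Max_ge)
  have "approx_dist \<alpha> (q, a) \<le> (\<Sum>j\<in>UNIV. \<bar>of_int q * \<alpha> $ j - of_int (a $ j)\<bar>)"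
    unfolding approx_dist_def by (rule order_trans[OF norm_le_l1_cart]) simp
  also have "\<dots> \<le> (\<Sum>j\<in>(UNIV :: 3 set). Q powr (- \<gamma>))" by (intro sum_mono c)
  finally show ?thesis using qa(2,3) by (intro that) simp_all
qed

lemma approx_system_of_approx_dist_le:
  assumes "1 \<le> q" "approx_dist \<alpha> (q, a) \<le> of_int q powr (- \<gamma>)"
  shows "approx_system \<alpha> \<gamma> (of_int q)"
proof -
  have "\<bar>of_int q * \<alpha> $ j - of_int (a $ j)\<bar> \<le> approx_dist \<alpha> (q, a)" for j
    using component_le_norm_cart[of "of_int q *\<^sub>R \<alpha> - (\<chi> j. of_int (a $ j))" j]
    by (simp add: approx_dist_def)
  then have "(MAX j\<in>UNIV. \<bar>of_int q * \<alpha> $ j - of_int (a $ j)\<bar>) \<le> of_int q powr (- \<gamma>)"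
    using assms(2) by (auto intro: order_trans)
  then show ?thesis using assms(1) unfolding approx_system_def by blast
qed

lemma eventually_approx_system:
  assumes "ereal \<gamma> < omega_hat \<alpha>"
  shows "\<forall>\<^sub>F Q in at_top. approx_system \<alpha> \<gamma> Q"
proof -
  obtain \<gamma>' where g: "\<forall>\<^sub>F Q in at_top. approx_system \<alpha> \<gamma>' Q" "\<gamma> < \<gamma>'"
    using assms by (auto simp: omega_hat_def less_SUP_iff)
  from g(1) eventually_ge_at_top[of 1] show ?thesis
  proof eventually_elim
    case (elim Q)
    then have "Q powr (- \<gamma>') \<le> Q powr (- \<gamma>)" using g(2) by (intro powr_mono) auto
    with elim(1) show ?case unfolding approx_system_def by (meson order_trans)
  qed
qed

lemma eventually_not_approx_system:
  assumes "omega \<alpha> < ereal \<gamma>"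
  shows "\<forall>\<^sub>F Q in at_top. \<not> approx_system \<alpha> \<gamma> Q"
proof (rule ccontr)
  assume "\<not> ?thesis"
  then have "ereal \<gamma> \<le> omega \<alpha>"
    unfolding omega_def by (intro SUP_upper) (simp add: frequently_def)
  then show False using assms by simp
qed

lemma omega_hat_le_omega: "omega_hat \<alpha> \<le> omega \<alpha>"
  unfolding omega_hat_def omega_def
  by (intro SUP_subset_mono) (auto intro: eventually_frequently)

lemma approx_dist_arbitrarily_small:
  assumes "0 < omega_hat \<alpha>" "0 < e"
  shows "\<exists>q a. 1 \<le> q \<and> approx_dist \<alpha> (q, a) < e"
proof -
  obtain \<gamma> where g: "0 < ereal \<gamma>" "ereal \<gamma> < omega_hat \<alpha>"
    using ereal_dense2[OF assms(1)] by auto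
  have "((\<lambda>Q. 3 * Q powr (- \<gamma>)) \<longlongrightarrow> 3 * 0) at_top"
    by (intro tendsto_intros tendsto_neg_powr filterlim_ident) (use g in auto)
  then have "\<forall>\<^sub>F Q in at_top. 3 * Q powr (- \<gamma>) < e"
    by (rule order_tendstoD) (use assms in simp)
  then have "\<forall>\<^sub>F Q in at_top. 3 * Q powr (- \<gamma>) < e \<and> approx_system \<alpha> \<gamma> Q"
    using eventually_approx_system[OF g(2)] by (rule eventually_conj)
  then obtain Q where "3 * Q powr (- \<gamma>) < e" "approx_system \<alpha> \<gamma> Q"
    using eventually_happens'[OF trivial_limit_at_top_linorder] by blast
  then show ?thesis by (metis approx_system_imp_approx_dist le_less_trans)
qed

text \<open>The sequence runs through the denominators at which the nearest-point distance
  \<open>f\<close> reaches a strict record minimum.\<close>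

lemma best_approx_seq_exists:
  assumes "lin_indep_over_rat \<alpha>" "\<And>e. 0 < e \<Longrightarrow> \<exists>q a. 1 \<le> q \<and> approx_dist \<alpha> (q, a) < e"
  shows "\<exists>z. best_approx_seq \<alpha> z"
proof -
  define near :: "nat \<Rightarrow> int \<times> (int^3)"
    where "near n = (int n, \<chi> j. round (of_int (int n) * \<alpha> $ j))" for n
  define f where "f n = approx_dist \<alpha> (near n)" for n
  have f_le: "f n \<le> approx_dist \<alpha> (int n, a)" for n a
    unfolding f_def near_def by (rule approx_dist_round_le)
  have f_pos: "0 < f n" if "1 \<le> n" for n
    unfolding f_def near_def using that assms(1) by (intro approx_dist_pos) auto
  define B where "B = {n. 1 \<le> n \<and> (\<forall>m. 1 \<le> m \<and> m < n \<longrightarrow> f n < f m)}"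
  have inf: "infinite B"
  proof
    assume "finite B"
    define N where "N = Max (insert 1 B)"
    have N: "\<And>n. n \<in> B \<Longrightarrow> n \<le> N" "1 \<le> N" using \<open>finite B\<close> by (auto simp: N_def)
    define e where "e = Min (f ` {1..N})"
    have e: "0 < e" "\<And>n. 1 \<le> n \<Longrightarrow> n \<le> N \<Longrightarrow> e \<le> f n"
      unfolding e_def using N f_pos by (auto simp: Min_gr_iff)
    obtain q a where "1 \<le> q" "approx_dist \<alpha> (q, a) < e" using assms(2)[OF e(1)] by blast
    then have "1 \<le> nat q \<and> f (nat q) < e" using f_le[of "nat q" a] by (auto simp: nat_le_iff)
    \<comment> \<open>The first denominator to beat \<open>e\<close>, the least distance up to
      \<open>N\<close>, is a record beyond \<open>N\<close>.\<close>
    define n where "n = (LEAST n. 1 \<le> n \<and> f n < e)"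
    have n: "1 \<le> n \<and> f n < e" unfolding n_def by (rule LeastI) fact
    have "e \<le> f m" if "1 \<le> m" "m < n" for m
      using not_less_Least[of m "\<lambda>n. 1 \<le> n \<and> f n < e"] that by (auto simp: n_def)
    with n have "n \<in> B" by (force simp: B_def)
    with N(1) e(2) n show False by force
  qed
  \<comment> \<open>\<open>enumerate\<close> counts from 0, the sequence from 1.\<close>
  define z where "z \<nu> = near (enumerate B (\<nu> - 1))" for \<nu>
  have fst_z: "fst (z \<nu>) = int (enumerate B (\<nu> - 1))" for \<nu> by (simp add: z_def near_def)
  have dist_z: "approx_dist \<alpha> (z \<nu>) = f (enumerate B (\<nu> - 1))" for \<nu> by (simp add: z_def f_def)
  have inB: "enumerate B n \<in> B" for n using inf by (rule enumerate_in_set)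
  have mono: "enumerate B (\<nu> - 1) < enumerate B \<nu>" if "1 \<le> \<nu>" for \<nu>
    using inf that by simp
  have "best_approx_seq \<alpha> z"
    unfolding best_approx_seq_def fst_z dist_z
  proof (intro conjI allI impI)
    show "1 \<le> int (enumerate B (1 - 1))" using inB[of 0] by (simp add: B_def)
  next
    fix \<nu> :: nat assume \<nu>: "1 \<le> \<nu>"
    show "int (enumerate B (\<nu> - 1)) < int (enumerate B (\<nu> + 1 - 1))" using mono[OF \<nu>] by simp
    have "1 \<le> enumerate B (\<nu> - 1)" using inB[of "\<nu> - 1"] by (simp add: B_def)
    then show "f (enumerate B (\<nu> + 1 - 1)) < f (enumerate B (\<nu> - 1))"
      using inB[of \<nu>] mono[OF \<nu>] by (simp add: B_def)
  next
    fix \<nu> :: nat and q a assume "1 \<le> \<nu>" and q: "1 \<le> q \<and> q \<le> int (enumerate B (\<nu> - 1))"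
    have "f (enumerate B (\<nu> - 1)) \<le> f (nat q)"
    proof (cases "nat q = enumerate B (\<nu> - 1)")
      case False
      then have "nat q < enumerate B (\<nu> - 1)" "1 \<le> nat q" using q by linarith+
      then show ?thesis using inB[of "\<nu> - 1"] by (simp add: B_def less_imp_le)
    qed simp
    also have "\<dots> \<le> approx_dist \<alpha> (q, a)" using f_le[of "nat q" a] q by simp
    finally show "f (enumerate B (\<nu> - 1)) \<le> approx_dist \<alpha> (q, a)" .
  next
    fix q a
    assume a: "1 \<le> q \<and> (\<forall>a'. approx_dist \<alpha> (q, a) \<le> approx_dist \<alpha> (q, a')) \<and>
        (\<forall>q' a'. 1 \<le> q' \<and> q' < q \<longrightarrow> approx_dist \<alpha> (q, a) < approx_dist \<alpha> (q', a'))"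
    have "f (nat q) < f m" if "1 \<le> m" "m < nat q" for m
    proof -
      have "f (nat q) \<le> approx_dist \<alpha> (q, a)" using f_le[of "nat q" a] a by simp
      also have "\<dots> < f m" using a that unfolding f_def near_def by auto
      finally show ?thesis .
    qed
    then have "nat q \<in> B" using a by (auto simp: B_def nat_le_iff)
    then obtain n where "enumerate B n = nat q" using enumerate_Ex[OF inf] by blast
    then show "\<exists>\<nu>\<ge>1. int (enumerate B (\<nu> - 1)) = q"
      using a by (intro exI[of _ "Suc n"]) simp
  qed
  then show ?thesis by blast
qed

lemma best_approx_seq_mono:
  assumes "best_approx_seq \<alpha> z" "1 \<le> \<mu>" "\<mu> \<le> \<nu>"
  shows "fst (z \<mu>) \<le> fst (z \<nu>)"
  using assms(3)
proof (induction rule: dec_induct)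
  case (step n)
  then have "fst (z n) < fst (z (n + 1))" using assms(1,2) by (auto simp: best_approx_seq_def)
  with step show ?case by simp
qed simp

text \<open>The least denominator admitting a closer point would be a record, hence by completeness
  the denominator of some \<open>z \<mu>\<close>. Lying below the next denominator forces
  \<open>\<mu> \<le> \<nu>\<close>, against the minimality of \<open>z \<nu>\<close>.\<close>

lemma best_approx_seq_next:
  assumes z: "best_approx_seq \<alpha> z" and "1 \<le> \<nu>" "1 \<le> q" "q < fst (z (\<nu> + 1))"
  shows "approx_dist \<alpha> (z \<nu>) \<le> approx_dist \<alpha> (q, a)"
proof (rule ccontr)
  define P where "P n \<longleftrightarrow> 1 \<le> n \<and> (\<exists>a. approx_dist \<alpha> (int n, a) < approx_dist \<alpha> (z \<nu>))" for n
  assume "\<not> ?thesis"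
  then have Pq: "P (nat q)" using assms(3) by (auto simp: P_def nat_le_iff not_le)
  define n where "n = (LEAST n. P n)"
  have "P n" unfolding n_def using Pq by (rule LeastI)
  then obtain a0 where n: "1 \<le> n" "approx_dist \<alpha> (int n, a0) < approx_dist \<alpha> (z \<nu>)"
    by (auto simp: P_def)
  define a1 where "a1 = (\<chi> j. round (of_int (int n) * \<alpha> $ j))"
  have a1: "approx_dist \<alpha> (int n, a1) \<le> approx_dist \<alpha> (int n, a)" for a
    unfolding a1_def by (rule approx_dist_round_le)
  have nq: "n \<le> nat q" unfolding n_def using Pq by (rule Least_le)
  have "approx_dist \<alpha> (int n, a1) < approx_dist \<alpha> (q', a')" if "1 \<le> q'" "q' < int n" for q' a'
  proof -
    have "\<not> P (nat q')" using that unfolding n_def by (intro not_less_Least) linarith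
    then have "approx_dist \<alpha> (z \<nu>) \<le> approx_dist \<alpha> (q', a')"
      using that by (auto simp: P_def nat_le_iff not_less)
    with n(2) a1[of a0] show ?thesis by linarith
  qed
  with a1 n(1) have "1 \<le> int n \<and>
      (\<forall>a'. approx_dist \<alpha> (int n, a1) \<le> approx_dist \<alpha> (int n, a')) \<and>
      (\<forall>q' a'. 1 \<le> q' \<and> q' < int n \<longrightarrow> approx_dist \<alpha> (int n, a1) < approx_dist \<alpha> (q', a'))"
    by auto
  then have "\<exists>\<mu>\<ge>1. fst (z \<mu>) = int n"
    using z unfolding best_approx_seq_def by blast
  then obtain \<mu> where \<mu>: "1 \<le> \<mu>" "fst (z \<mu>) = int n" by blast
  have "\<mu> \<le> \<nu>"
  proof (rule ccontr)
    assume "\<not> \<mu> \<le> \<nu>"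
    then have "fst (z (\<nu> + 1)) \<le> fst (z \<mu>)" by (intro best_approx_seq_mono[OF z]) auto
    with \<mu> nq assms(3,4) show False by linarith
  qed
  then have "int n \<le> fst (z \<nu>)" using best_approx_seq_mono[OF z \<mu>(1)] \<mu>(2) by metis
  then have "approx_dist \<alpha> (z \<nu>) \<le> approx_dist \<alpha> (int n, a0)"
    using z n(1) assms(2) unfolding best_approx_seq_def by auto
  with n(2) show False by simp
qed

subsection \<open>Good indices\<close>

text \<open>The hypotheses make distances positive yet arbitrarily small, so best approximations
  exist and the choice in \<open>best_approx\<close> is genuine.\<close>

locale approximable_point =
  fixes \<alpha> :: "real^3"
  assumes lin_indep: "lin_indep_over_rat \<alpha>" and omega_hat_pos: "0 < omega_hat \<alpha>"
begin

abbreviation V :: "nat \<Rightarrow> real \<times> (real^3)" where "V \<equiv> best_vec \<alpha>"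
abbreviation q :: "nat \<Rightarrow> real" where "q \<nu> \<equiv> fst (V \<nu>)"
abbreviation \<xi> :: "nat \<Rightarrow> real" where "\<xi> \<nu> \<equiv> norm (offset \<alpha> (V \<nu>))"

lemma best_approx_seq_best_approx: "best_approx_seq \<alpha> (best_approx \<alpha>)"
  unfolding best_approx_def
  using best_approx_seq_exists[OF lin_indep approx_dist_arbitrarily_small[OF omega_hat_pos]]
  by (rule someI_ex[of "best_approx_seq \<alpha>"])

lemma q_eq: "q \<nu> = of_int (fst (best_approx \<alpha> \<nu>))"
  by (simp add: best_vec_def)

lemma xi_eq: "\<xi> \<nu> = approx_dist \<alpha> (best_approx \<alpha> \<nu>)"
  by (simp add: offset_def best_vec_def approx_dist_def)

lemma integral_point_V: "integral_point (V \<nu>)"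
  by (simp add: integral_point_def best_vec_def)

lemma q_less_Suc: "1 \<le> \<nu> \<Longrightarrow> q \<nu> < q (Suc \<nu>)"
  using best_approx_seq_best_approx by (simp add: q_eq best_approx_seq_def)

lemma q_less: "1 \<le> \<mu> \<Longrightarrow> \<mu> < \<nu> \<Longrightarrow> q \<mu> < q \<nu>"
proof (induction \<nu>)
  case (Suc \<nu>)
  then show ?case using q_less_Suc[of \<nu>] by (cases "\<mu> = \<nu>") auto
qed simp

lemma xi_less_Suc: "1 \<le> \<nu> \<Longrightarrow> \<xi> (Suc \<nu>) < \<xi> \<nu>"
  using best_approx_seq_best_approx by (simp add: xi_eq best_approx_seq_def)

lemma xi_less: "1 \<le> \<mu> \<Longrightarrow> \<mu> < \<nu> \<Longrightarrow> \<xi> \<nu> < \<xi> \<mu>"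
proof (induction \<nu>)
  case (Suc \<nu>)
  then show ?case using xi_less_Suc[of \<nu>] by (cases "\<mu> = \<nu>") auto
qed simp

lemma q_ge_index: "1 \<le> \<nu> \<Longrightarrow> real \<nu> \<le> q \<nu>"
proof -
  assume "1 \<le> \<nu>"
  then have "int \<nu> \<le> fst (best_approx \<alpha> \<nu>)"
  proof (induction \<nu> rule: dec_induct)
    case base
    then show ?case using best_approx_seq_best_approx by (simp add: best_approx_seq_def)
  next
    case (step n)
    then have "fst (best_approx \<alpha> n) < fst (best_approx \<alpha> (n + 1))"
      using best_approx_seq_best_approx by (auto simp: best_approx_seq_def)
    with step show ?case by simp
  qed
  then show "real \<nu> \<le> q \<nu>" unfolding q_eq by linarith
qed

lemma q_ge_1: "1 \<le> \<nu> \<Longrightarrow> 1 \<le> q \<nu>"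
  using q_ge_index[of \<nu>] by linarith

lemma xi_pos: "1 \<le> \<nu> \<Longrightarrow> 0 < \<xi> \<nu>"
  using xi_less_Suc[of \<nu>] norm_ge_zero by (rule le_less_trans[rotated])

lemma V_neq: "1 \<le> \<mu> \<Longrightarrow> \<mu> < \<nu> \<Longrightarrow> V \<mu> \<noteq> V \<nu>"
  using q_less[of \<mu> \<nu>] by auto

text \<open>If the later vector were \<open>c\<close> times the earlier, growing denominators would
  give \<open>c > 1\<close>, whereas the distances, also scaled by \<open>c\<close>,
  decrease.\<close>

lemma independent_consecutive:
  assumes "1 \<le> \<nu>"
  shows "independent {V \<nu>, V (Suc \<nu>)}"
proof -
  have "V (Suc \<nu>) \<notin> span {V \<nu>}"
  proof
    assume "V (Suc \<nu>) \<in> span {V \<nu>}"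
    then obtain c where c: "V (Suc \<nu>) = c *\<^sub>R V \<nu>" by (auto simp: span_singleton)
    have "q \<nu> < c * q \<nu>" using q_less_Suc[OF assms] by (simp add: c)
    then have "1 < c" using q_ge_1[OF assms] by simp
    moreover have "offset \<alpha> (V (Suc \<nu>)) = c *\<^sub>R offset \<alpha> (V \<nu>)"
      by (simp add: c offset_def algebra_simps)
    then have "\<xi> (Suc \<nu>) = \<bar>c\<bar> * \<xi> \<nu>" by simp
    ultimately show False using xi_less_Suc[OF assms] xi_pos[OF assms] by simp
  qed
  moreover have "V \<nu> \<noteq> 0" using q_ge_1[OF assms] by auto
  ultimately show ?thesis
    by (simp add: insert_commute[of "V \<nu>"] independent_insertI)
qed

text \<open>Both consecutive pairs are independent, so dependence of the triple puts each outer
  vector into the plane of the other two.\<close>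

lemma span_consecutive_eq_if_not_good:
  assumes "1 \<le> \<mu>" "Suc \<mu> \<notin> good_indices \<alpha>"
  shows "span {V \<mu>, V (Suc \<mu>)} = span {V (Suc \<mu>), V (Suc (Suc \<mu>))}"
proof -
  have dep: "dependent {V \<mu>, V (Suc \<mu>), V (Suc (Suc \<mu>))}"
    using assms by (auto simp: good_indices_def best_triple_def)
  then have "dependent (insert (V (Suc (Suc \<mu>))) {V \<mu>, V (Suc \<mu>)})"
    by (simp add: insert_commute)
  then have "V (Suc (Suc \<mu>)) \<in> span {V \<mu>, V (Suc \<mu>)}"
    using independent_insertI independent_consecutive[OF assms(1)] by blast
  moreover have "V \<mu> \<in> span {V (Suc \<mu>), V (Suc (Suc \<mu>))}"
    using dep independent_insertI independent_consecutive[of "Suc \<mu>"] by fastforce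
  ultimately show ?thesis by (auto simp: span_eq span_base)
qed

abbreviation n :: "nat \<Rightarrow> nat" where "n \<equiv> good_index \<alpha>"
abbreviation \<Lambda> :: "nat \<Rightarrow> (real \<times> (real^3)) set" where "\<Lambda> i \<equiv> span (best_triple \<alpha> (n i))"

section \<open>Planes and hyperplanes at consecutive good indices\<close>

context
  assumes infinite_good: "infinite (good_indices \<alpha>)"
begin

lemma good_index_in: "n i \<in> good_indices \<alpha>"
  unfolding good_index_def using infinite_good by (rule enumerate_in_set)

lemma good_index_ge_2: "2 \<le> n i"
  using good_index_in[of i] by (simp add: good_indices_def)

lemma good_index_less_Suc: "n i < n (Suc i)"
  unfolding good_index_def using infinite_good by (rule enumerate_step)

lemma le_good_index: "i \<le> n i"
  unfolding good_index_def using infinite_good by (rule le_enumerate)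

lemma not_good_between:
  assumes "n i < m" "m < n (Suc i)"
  shows "m \<notin> good_indices \<alpha>"
proof
  assume "m \<in> good_indices \<alpha>"
  then obtain j where "n j = m" using enumerate_Ex[OF infinite_good] unfolding good_index_def by blast
  then show False using assms infinite_good by (auto simp: good_index_def)
qed

text \<open>The plane of two consecutive vectors can turn only at a good index.\<close>

lemma span_consecutive_between_good:
  assumes "n i \<le> m" "m < n (Suc i)"
  shows "span {V m, V (Suc m)} = span {V (n i), V (Suc (n i))}"
  using assms
proof (induction m rule: dec_induct)
  case (step m)
  have "span {V m, V (Suc m)} = span {V (Suc m), V (Suc (Suc m))}"
    using step good_index_ge_2[of i] not_good_between[of i "Suc m"]
    by (intro span_consecutive_eq_if_not_good) auto
  with step show ?case by simp
qed simp

lemma span_before_next_good: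
  "span {V (n (Suc i) - 1), V (n (Suc i))} = span {V (n i), V (Suc (n i))}"
  using span_consecutive_between_good[of i "n (Suc i) - 1"] good_index_less_Suc[of i] by simp

text \<open>Chosen for its wedge bound
  \<open>q (n (Suc i)) * \<xi> (n i - 1) * \<xi> (n (Suc i) - 1)\<close>: the uniform estimate turns
  both distances into powers of the denominators at \<open>n i\<close> and
  \<open>n (Suc i)\<close>.\<close>

definition linking_triple :: "nat \<Rightarrow> (real \<times> (real^3)) set" where
  "linking_triple i = {V (n i - 1), V (n (Suc i) - 1), V (n (Suc i))}"

lemma span_linking_triple: "span (linking_triple i) = \<Lambda> i"
proof -
  have "span (insert a S) = span (insert a T)" if "span S = span T" for a and S T :: "(real \<times> (real^3)) set"
    unfolding insert_is_Un[of a S] insert_is_Un[of a T] span_Un that ..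
  from this[OF span_before_next_good] show ?thesis
    by (simp add: linking_triple_def best_triple_def)
qed

lemma independent_best_triple: "independent (best_triple \<alpha> (n i))"
  using good_index_in[of i] by (simp add: good_indices_def)

lemma card_best_triple: "card (best_triple \<alpha> (n i)) = 3"
  using good_index_ge_2[of i] V_neq[of "n i - 1" "n i"] V_neq[of "n i - 1" "Suc (n i)"]
    V_neq[of "n i" "Suc (n i)"]
  by (simp add: best_triple_def)

lemma independent_linking_triple: "independent (linking_triple i)"
proof -
  have "card (linking_triple i) \<le> 3"
    unfolding linking_triple_def by (auto simp: card_insert_if)
  moreover have "dim (linking_triple i) = 3"
    using dim_eq_card_independent[OF independent_best_triple[of i]] card_best_triple[of i]
    by (metis dim_span span_linking_triple)
  ultimately show ?thesis
    by (intro card_le_dim_spanning[of _ "\<Lambda> i"])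
       (auto simp: linking_triple_def simp flip: span_linking_triple intro: span_base)
qed

lemma wedge_in_integral_normals:
  assumes "1 \<le> a" "a < b" "b < c" "independent {V a, V b, V c}"
  shows "wedge (V a) (V b) (V c) \<in> integral_normals {V a, V b, V c}"
    and "norm (snd (wedge (V a) (V b) (V c))) \<le> 3 * (q c * \<xi> a * \<xi> b)"
proof -
  have "snd (wedge (V a) (V b) (V c)) \<noteq> 0"
    using assms V_neq[of a b] V_neq[of a c] V_neq[of b c] q_ge_1[of a]
    by (intro snd_wedge_nonzero) auto
  then show "wedge (V a) (V b) (V c) \<in> integral_normals {V a, V b, V c}"
    unfolding integral_normals_def
    using integral_point_wedge[OF integral_point_V integral_point_V integral_point_V] wedge_orthogonal
    by blast
  show "norm (snd (wedge (V a) (V b) (V c))) \<le> 3 * (q c * \<xi> a * \<xi> b)"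
    using assms q_ge_1[of a] q_ge_1[of b] q_less[of a c] q_less[of b c] xi_less[of a c] xi_less[of b c]
    by (intro norm_snd_wedge_le) auto
qed

lemma inner_V_eq: "p \<bullet> V \<nu> = q \<nu> * (fst p + snd p \<bullet> \<alpha>) - snd p \<bullet> offset \<alpha> (V \<nu>)"
  by (simp add: inner_prod_def offset_def inner_diff_right algebra_simps)

text \<open>One \<open>b\<close> serves all bounds: by minimality every wedge from the common
  hyperplane bounds it above, while the letter B provides a vector off that hyperplane and so the
  last inequality.\<close>

lemma AkB_inequalities:
  assumes occ: "AjB_occurs_at (pattern_word \<alpha>) k i"
  obtains b where "1 \<le> b" "b \<le> 3 * (q (Suc (n i)) * \<xi> (n i - 1) * \<xi> (n i))"
    "\<forall>j\<le>k. b \<le> 3 * (q (n (Suc (i + j))) * \<xi> (n (i + j) - 1) * \<xi> (n (Suc (i + j)) - 1))"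
    "q (n (Suc (i + k))) \<le> 2 * (b * \<xi> (n (Suc (i + k))) * q (Suc (n (Suc (i + k)))))"
proof -
  have same: "\<Lambda> (i + j) = \<Lambda> i" if "j \<le> k" for j
    using that
  proof (induction j)
    case (Suc j)
    then have "pattern_word \<alpha> (i + j) = Letter_A" using occ by (simp add: AjB_occurs_at_def)
    with Suc show ?case by (simp add: pattern_word_def split: if_splits)
  qed simp
  define m where "m = n (Suc (i + k))"
  have m: "2 \<le> m" unfolding m_def by (rule good_index_ge_2)
  have other: "span (best_triple \<alpha> m) \<noteq> \<Lambda> i"
    using occ same[of k] by (auto simp: AjB_occurs_at_def pattern_word_def m_def split: if_splits)
  have triple: "{V (n i - 1), V (n i), V (Suc (n i))} = best_triple \<alpha> (n i)"
    by (simp add: best_triple_def)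
  define w where "w = wedge (V (n i - 1)) (V (n i)) (V (Suc (n i)))"
  have w: "w \<in> integral_normals (best_triple \<alpha> (n i))"
    "norm (snd w) \<le> 3 * (q (Suc (n i)) * \<xi> (n i - 1) * \<xi> (n i))"
    unfolding w_def
    using wedge_in_integral_normals[of "n i - 1" "n i" "Suc (n i)", unfolded triple]
      good_index_ge_2[of i] independent_best_triple[of i] by auto
  obtain p where p: "p \<in> integral_normals (best_triple \<alpha> (n i))"
    and p_min: "\<And>p'. p' \<in> integral_normals (best_triple \<alpha> (n i)) \<Longrightarrow> norm (snd p) \<le> norm (snd p')"
    using minimal_integral_normal[OF w(1)] by blast
  have hyp: "\<Lambda> i = {x. p \<bullet> x = 0}"
    by (rule span_eq_hyperplane[OF independent_best_triple card_best_triple p])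
  have link: "linking_triple (i + j) \<subseteq> \<Lambda> i" if "j \<le> k" for j
    using span_superset[of "linking_triple (i + j)"] by (simp only: span_linking_triple same[OF that])
  show ?thesis
  proof (rule that[of "norm (snd p)"])
    show "1 \<le> norm (snd p)" using p by (rule norm_integral_normal_ge_1)
    show "norm (snd p) \<le> 3 * (q (Suc (n i)) * \<xi> (n i - 1) * \<xi> (n i))"
      using p_min[OF w(1)] w(2) by linarith
  next
    have "norm (snd p) \<le> 3 * (q (n (Suc (i + j))) * \<xi> (n (i + j) - 1) * \<xi> (n (Suc (i + j)) - 1))"
      if j: "j \<le> k" for j
    proof -
      let ?w = "wedge (V (n (i + j) - 1)) (V (n (Suc (i + j)) - 1)) (V (n (Suc (i + j))))"
      have ineq: "1 \<le> n (i + j) - 1" "n (i + j) - 1 < n (Suc (i + j)) - 1"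
        "n (Suc (i + j)) - 1 < n (Suc (i + j))"
        using good_index_ge_2[of "i + j"] good_index_less_Suc[of "i + j"] by auto
      note ww = wedge_in_integral_normals[OF ineq independent_linking_triple[unfolded linking_triple_def]]
      have "?w \<in> integral_normals (best_triple \<alpha> (n i))"
        using ww(1) integral_normals_cong_span[of "linking_triple (i + j)" "best_triple \<alpha> (n i)"]
        unfolding linking_triple_def[symmetric] span_linking_triple same[OF j] by simp
      from p_min[OF this] ww(2) show ?thesis by linarith
    qed
    then show "\<forall>j\<le>k. norm (snd p)
        \<le> 3 * (q (n (Suc (i + j))) * \<xi> (n (i + j) - 1) * \<xi> (n (Suc (i + j)) - 1))" by blast
  next
    \<comment> \<open>Both vectors belong to the last linking triple, which still lies in the common
      hyperplane.\<close>
    have Vm: "p \<bullet> V m = 0" "p \<bullet> V (m - 1) = 0"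
      using link[of k] by (auto simp: hyp linking_triple_def m_def)
    \<comment> \<open>Otherwise the triple at \<open>m\<close> would span the same hyperplane,
      against the letter B.\<close>
    have "p \<bullet> V (Suc m) \<noteq> 0"
    proof
      assume "p \<bullet> V (Suc m) = 0"
      with Vm have "p \<in> integral_normals (best_triple \<alpha> m)"
        using p by (auto simp: integral_normals_def best_triple_def)
      then have "span (best_triple \<alpha> m) = {x. p \<bullet> x = 0}"
        unfolding m_def by (intro span_eq_hyperplane independent_best_triple card_best_triple)
      with hyp other show False by simp
    qed
    moreover have "p \<bullet> V (Suc m) \<in> \<int>"
      using p integral_point_V[of "Suc m"]
      by (auto simp: integral_normals_def integral_point_def inner_prod_def inner_vec_def)
    ultimately have "1 \<le> \<bar>p \<bullet> V (Suc m)\<bar>" by (rule Ints_nonzero_abs_ge1[rotated])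
    define \<eta> where "\<eta> = \<bar>fst p + snd p \<bullet> \<alpha>\<bar>"
    define b where "b = norm (snd p)"
    have qm: "1 \<le> q m" using m by (intro q_ge_1) simp
    have "q m * \<eta> = \<bar>q m * (fst p + snd p \<bullet> \<alpha>)\<bar>" using qm by (simp add: abs_mult \<eta>_def)
    also have "\<dots> = \<bar>snd p \<bullet> offset \<alpha> (V m)\<bar>" using Vm(1) by (simp add: inner_V_eq)
    finally have "q m * \<eta> = \<bar>snd p \<bullet> offset \<alpha> (V m)\<bar>" .
    then have 1: "q m * \<eta> \<le> b * \<xi> m" by (simp add: b_def Cauchy_Schwarz_ineq2)
    have "1 \<le> \<bar>q (Suc m) * (fst p + snd p \<bullet> \<alpha>)\<bar> + \<bar>snd p \<bullet> offset \<alpha> (V (Suc m))\<bar>"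
      using \<open>1 \<le> \<bar>p \<bullet> V (Suc m)\<bar>\<close> unfolding inner_V_eq by linarith
    also have "\<dots> \<le> q (Suc m) * \<eta> + b * \<xi> (Suc m)"
      using Cauchy_Schwarz_ineq2[of "snd p" "offset \<alpha> (V (Suc m))"] q_ge_1[of "Suc m"]
      by (simp add: \<eta>_def b_def abs_mult)
    also have "b * \<xi> (Suc m) \<le> b * \<xi> m"
      using xi_less_Suc[of m] m by (intro mult_left_mono) (auto simp: b_def)
    \<comment> \<open>The factor \<open>q m\<close> makes \<open>q m * \<eta>\<close> appear, which
      orthogonality at \<open>m\<close> bounds by \<open>b * \<xi> m\<close>.\<close>
    finally have "q m * 1 \<le> q m * (q (Suc m) * \<eta> + b * \<xi> m)"
      using qm by (intro mult_left_mono) auto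
    also have "\<dots> = q (Suc m) * (q m * \<eta>) + q m * (b * \<xi> m)" by (simp add: algebra_simps)
    also have "\<dots> \<le> q (Suc m) * (b * \<xi> m) + q (Suc m) * (b * \<xi> m)"
      using q_ge_1[of "Suc m"] q_less_Suc[of m] m 1
      by (intro add_mono mult_left_mono mult_right_mono) (auto simp: b_def)
    finally show "q (n (Suc (i + k))) \<le> 2 * (norm (snd p) * \<xi> (n (Suc (i + k))) * q (Suc (n (Suc (i + k)))))"
      by (simp add: m_def b_def algebra_simps)
  qed
qed

end

end

subsection \<open>The pattern inequality\<close>

text \<open>With weights \<open>theta l ^ j\<close> the chain telescopes, and the coefficients of
  \<open>E\<close> add up to the sum.\<close>

lemma S_sum_descent:
  assumes "0 \<le> theta l" "\<And>j. j \<le> k \<Longrightarrow> X j + E \<le> theta l * X (Suc j)"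
  shows "X 0 + S_sum (Suc k) l * E \<le> theta l ^ Suc k * X (Suc k)"
  using assms(2)
proof (induction k)
  case 0
  from 0[of 0] show ?case by (simp add: S_sum_def)
next
  case (Suc k)
  have "theta l ^ Suc k * (X (Suc k) + E) \<le> theta l ^ Suc k * (theta l * X (Suc (Suc k)))"
    using Suc.prems[of "Suc k"] assms(1) by (intro mult_left_mono) auto
  moreover have "X 0 + S_sum (Suc k) l * E \<le> theta l ^ Suc k * X (Suc k)"
    using Suc by simp
  ultimately show ?case unfolding S_sum_Suc[of "Suc k"] by (simp add: algebra_simps)
qed

text \<open>Used to discard bounded errors: at arbitrarily large \<open>X\<close> only the sign of
  the coefficient matters.\<close>

lemma nonpos_if_bounded_multiples:
  fixes c K :: real
  assumes "\<And>M. \<exists>X\<ge>M. c * X \<le> K"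
  shows "c \<le> 0"
proof (rule ccontr)
  assume c: "\<not> c \<le> 0"
  obtain X where X: "X \<ge> (K + 1) / c" "c * X \<le> K" using assms by blast
  have "K + 1 \<le> c * X" using X(1) c by (simp add: pos_divide_le_eq mult.commute)
  with X(2) show False by simp
qed

text \<open>Once all elements are removed, \<open>enumerate\<close> keeps returning
  \<open>LEAST\<close> over the empty set, one fixed though unspecified value.\<close>

lemma enumerate_ge_card:
  fixes S :: "nat set"
  assumes "finite S" "card S \<le> i"
  shows "enumerate S i = (LEAST x. x \<in> ({} :: nat set))"
  using assms
proof (induction i arbitrary: S)
  case (Suc i)
  show ?case
  proof (cases "S = {}")
    case False
    then have "(LEAST x. x \<in> S) \<in> S" by (meson LeastI ex_in_conv)
    with Suc show ?thesis by (simp add: enumerate_Suc)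
  next
    case True
    with Suc.IH[of "{}"] show ?thesis by (simp add: enumerate_Suc)
  qed
qed (simp add: enumerate_0)

text \<open>\<open>enumerate\<close> is eventually constant on a finite set, so then only the letter \<open>A\<close> remains.\<close>

lemma infinite_good_indices:
  assumes "infinite {i. AjB_occurs_at (pattern_word \<alpha>) j i}"
  shows "infinite (good_indices \<alpha>)"
proof
  assume fin: "finite (good_indices \<alpha>)"
  have A: "pattern_word \<alpha> i = Letter_A" if "card (good_indices \<alpha>) \<le> i" for i
    using enumerate_ge_card[OF fin that] enumerate_ge_card[OF fin, of "Suc i"] that
    by (simp add: pattern_word_def good_index_def)
  have "i < card (good_indices \<alpha>)" if "AjB_occurs_at (pattern_word \<alpha>) j i" for i
    using that A[of "i + j"] by (cases "i < card (good_indices \<alpha>)") (auto simp: AjB_occurs_at_def)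
  then have "{i. AjB_occurs_at (pattern_word \<alpha>) j i} \<subseteq> {..<card (good_indices \<alpha>)}" by blast
  with assms show False using finite_subset by blast
qed

section \<open>Logarithmic estimates from the two exponents\<close>

context approximable_point
begin

lemma uniform_bound:
  assumes "0 < \<gamma>" "ereal \<gamma> < omega_hat \<alpha>"
  obtains C N where "0 \<le> C" "1 \<le> N" "\<forall>\<nu>\<ge>N. \<gamma> * ln (q (Suc \<nu>)) - C \<le> - ln (\<xi> \<nu>)"
proof -
  obtain Q0 where Q0: "\<And>Q. Q0 \<le> Q \<Longrightarrow> approx_system \<alpha> \<gamma> Q"
    using eventually_approx_system[OF assms(2)] by (auto simp: eventually_at_top_linorder)
  define N where "N = Suc (nat \<lceil>2 * Q0\<rceil>)"
  show ?thesis
  proof (rule that[of "ln 3 + \<gamma> * ln 2" N])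
    show "0 \<le> ln 3 + \<gamma> * ln 2" using assms by simp
    show "1 \<le> N" by (simp add: N_def)
    show "\<forall>\<nu>\<ge>N. \<gamma> * ln (q (Suc \<nu>)) - (ln 3 + \<gamma> * ln 2) \<le> - ln (\<xi> \<nu>)"
    proof (intro allI impI)
      fix \<nu> assume \<nu>: "N \<le> \<nu>"
      have \<nu>1: "1 \<le> \<nu>" using \<nu> by (simp add: N_def)
      \<comment> \<open>Half the next denominator keeps the solution strictly below it, as
        \<open>best_approx_seq_next\<close> requires. Halving costs \<open>\<gamma> * ln 2\<close>,
        the change of norm \<open>ln 3\<close>.\<close>
      define Q where "Q = q (Suc \<nu>) / 2"
      have "2 * Q0 \<le> real \<nu>" using \<nu> unfolding N_def by linarith
      then have "Q0 \<le> Q" "0 < Q" "Q < q (Suc \<nu>)"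
        using q_ge_index[of "Suc \<nu>"] by (auto simp: Q_def)
      from approx_system_imp_approx_dist[OF Q0[OF this(1)]] obtain r a
        where r: "1 \<le> r" "of_int r \<le> Q" "approx_dist \<alpha> (r, a) \<le> 3 * Q powr (- \<gamma>)" .
      have "r < fst (best_approx \<alpha> (\<nu> + 1))"
        using r(2) \<open>Q < q (Suc \<nu>)\<close> by (simp add: q_eq)
      then have "\<xi> \<nu> \<le> 3 * Q powr (- \<gamma>)"
        using order_trans[OF best_approx_seq_next[OF best_approx_seq_best_approx \<nu>1 r(1)] r(3)]
        unfolding xi_eq by simp
      then have "ln (\<xi> \<nu>) \<le> ln (3 * Q powr (- \<gamma>))"
        using xi_pos[OF \<nu>1] \<open>0 < Q\<close> by (subst ln_le_cancel_iff) auto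
      also have "\<dots> = ln 3 - \<gamma> * (ln (q (Suc \<nu>)) - ln 2)"
        using \<open>0 < Q\<close> by (simp add: ln_mult ln_div Q_def)
      finally show "\<gamma> * ln (q (Suc \<nu>)) - (ln 3 + \<gamma> * ln 2) \<le> - ln (\<xi> \<nu>)"
        by (simp add: algebra_simps)
    qed
  qed
qed

text \<open>Otherwise the best approximation itself would solve the system at
  \<open>Q = q \<nu>\<close>.\<close>

lemma ordinary_bound:
  assumes "omega \<alpha> < ereal w"
  obtains N where "\<forall>\<nu>\<ge>N. - ln (\<xi> \<nu>) \<le> w * ln (q \<nu>)"
proof -
  obtain Q0 where Q0: "\<And>Q. Q0 \<le> Q \<Longrightarrow> \<not> approx_system \<alpha> w Q"
    using eventually_not_approx_system[OF assms] by (auto simp: eventually_at_top_linorder)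
  show ?thesis
  proof (rule that[of "Suc (nat \<lceil>Q0\<rceil>)"], intro allI impI)
    fix \<nu> assume \<nu>: "Suc (nat \<lceil>Q0\<rceil>) \<le> \<nu>"
    then have \<nu>1: "1 \<le> \<nu>" by simp
    have q1: "1 \<le> q \<nu>" using \<nu>1 by (rule q_ge_1)
    have "Q0 \<le> q \<nu>" using \<nu> q_ge_index[OF \<nu>1] by linarith
    then have "\<not> approx_system \<alpha> w (q \<nu>)" by (rule Q0)
    then have "\<not> approx_dist \<alpha> (best_approx \<alpha> \<nu>) \<le> q \<nu> powr (- w)"
      using approx_system_of_approx_dist_le[of "fst (best_approx \<alpha> \<nu>)" \<alpha> "snd (best_approx \<alpha> \<nu>)" w] q1
      by (auto simp: q_eq)
    then have "ln (q \<nu> powr (- w)) \<le> ln (\<xi> \<nu>)"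
      using q1 by (subst ln_le_cancel_iff) (auto simp: xi_eq xi_pos[OF \<nu>1, unfolded xi_eq])
    then show "- ln (\<xi> \<nu>) \<le> w * ln (q \<nu>)" using q1 by simp
  qed
qed

text \<open>Strict inequalities around both exponents make the estimates valid at all large indices;
  the exact exponents are reached by a limit afterwards.\<close>

lemma R_poly_nonneg_approx:
  assumes \<gamma>: "0 < \<gamma>" "\<gamma> < 1" "ereal \<gamma> < omega_hat \<alpha>" and w: "omega \<alpha> < ereal w"
    and k: "1 \<le> k" and inf: "infinite {i. AjB_occurs_at (pattern_word \<alpha>) k i}"
  shows "1 \<le> theta \<gamma> * (w / \<gamma>) \<and> 0 \<le> R_poly k (w / \<gamma>) \<gamma>"
proof -
  note ig = infinite_good_indices[OF inf]
  define t where "t = theta \<gamma>"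
  define g where "g = w / \<gamma>"
  define h where "h = t * g"
  have t: "0 < t" using \<gamma> by (simp add: t_def theta_pos)
  have t_alt: "1 + t = 1 / \<gamma>" "t = (1 - \<gamma>) / \<gamma>" using \<gamma> by (simp_all add: t_def theta_def field_simps)
  obtain C N1 where C: "0 \<le> C" "1 \<le> N1"
    "\<forall>\<nu>\<ge>N1. \<gamma> * ln (q (Suc \<nu>)) - C \<le> - ln (\<xi> \<nu>)"
    using uniform_bound[OF \<gamma>(1,3)] .
  obtain N2 where N2: "\<forall>\<nu>\<ge>N2. - ln (\<xi> \<nu>) \<le> w * ln (q \<nu>)"
    using ordinary_bound[OF w] .
  \<comment> \<open>One constant dominating the errors in all the bounds on \<open>E\<close>
    below.\<close>
  define C1 where "C1 = (ln 3 + 2 * C + t * C) / \<gamma>"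
  \<comment> \<open>The uniform exponent bounds \<open>- ln (\<xi> \<nu>)\<close> below by the next
    denominator, the ordinary one bounds it above by the current denominator.\<close>
  have growth: "ln (q (Suc \<nu>)) \<le> g * ln (q \<nu>) + C / \<gamma>" if "N1 \<le> \<nu>" "N2 \<le> \<nu>" for \<nu>
  proof -
    have "\<gamma> * ln (q (Suc \<nu>)) \<le> w * ln (q \<nu>) + C" using C(3)[rule_format, OF that(1)] N2[rule_format, OF that(2)] by linarith
    then show ?thesis using \<gamma>(1) by (simp add: g_def field_simps)
  qed
  have scale: "x / \<gamma> \<le> c / \<gamma> + t * y - z" if "x \<le> c + (1 - \<gamma>) * y - \<gamma> * z" for x c y z
  proof -
    have "x / \<gamma> \<le> (c + (1 - \<gamma>) * y - \<gamma> * z) / \<gamma>" using that \<gamma>(1) by (simp add: divide_right_mono)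
    also have "\<dots> = c / \<gamma> + t * y - z"
      using \<gamma>(1) by (simp add: t_alt(2) field_simps)
    finally show ?thesis .
  qed
  have ln3: "ln 2 \<le> (ln 3 :: real)" by simp
  define S where "S = S_sum (Suc k) \<gamma>"
  have S: "1 \<le> S" unfolding S_def using \<gamma> by (intro S_sum_ge_1)
  \<comment> \<open>\<open>X0\<close> and \<open>X\<close> are logarithms of denominators at the
    first and last good index of an occurrence, and \<open>E\<close> is
    \<open>ln b / \<gamma>\<close>.\<close>
  have occ: "\<exists>X0 X E. M \<le> X0 \<and> M \<le> X \<and> 0 \<le> E \<and> E \<le> (h - 1) * X0 + C1 \<and>
      (1 + t - h) * X \<le> E + C1 \<and> X0 + S * (E - C1) \<le> t ^ Suc k * X" for M
  proof -
    \<comment> \<open>\<open>Suc\<close> keeps even the predecessor of a good index beyond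
      \<open>N1\<close>, and \<open>exp M\<close> makes the logarithms exceed
      \<open>M\<close>.\<close>
    define N where "N = Suc (N1 + N2 + nat \<lceil>exp M\<rceil>)"
    obtain i where i: "N \<le> i" "AjB_occurs_at (pattern_word \<alpha>) k i"
      using inf unfolding infinite_nat_iff_unbounded_le by auto
    obtain b where b: "1 \<le> b" "b \<le> 3 * (q (Suc (n i)) * \<xi> (n i - 1) * \<xi> (n i))"
      "\<forall>j\<le>k. b \<le> 3 * (q (n (Suc (i + j))) * \<xi> (n (i + j) - 1) * \<xi> (n (Suc (i + j)) - 1))"
      "q (n (Suc (i + k))) \<le> 2 * (b * \<xi> (n (Suc (i + k))) * q (Suc (n (Suc (i + k)))))"
      using AkB_inequalities[OF ig i(2)] .
    define X where "X j = ln (q (n (i + j)))" for j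
    define D where "D = ln b"
    have n_ge: "N \<le> n (i + j)" for j
      using le_good_index[OF ig, of "i + j"] i(1) by linarith
    have n_ge1: "1 \<le> n (i + j) - 1" "N1 \<le> n (i + j) - 1" "N1 \<le> n (i + j)" "N2 \<le> n (i + j)"
      "1 \<le> n (i + j)" "Suc (n (i + j) - 1) = n (i + j)" for j
      using n_ge[of j] C(2) by (auto simp: N_def)
    have x_ge: "\<gamma> * X j - C \<le> - ln (\<xi> (n (i + j) - 1))" for j
      using C(3)[rule_format, OF n_ge1(2)[of j]] n_ge1(6)[of j] by (simp add: X_def)
    have X_ge: "M \<le> X j" for j
    proof -
      have "exp M \<le> real (n (i + j))" using n_ge[of j] unfolding N_def by linarith
      also have "\<dots> \<le> q (n (i + j))" by (rule q_ge_index[OF n_ge1(5)])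
      finally show ?thesis unfolding X_def by (subst ln_ge_iff) (use q_ge_1[OF n_ge1(5)[of j]] in auto)
    qed
    have ln_prod: "ln b \<le> ln 3 + ln x + ln y + ln z" if "b \<le> 3 * (x * y * z)" "0 < x" "0 < y" "0 < z" for x y z
    proof -
      have "ln b \<le> ln (3 * (x * y * z))" using that b(1) by (subst ln_le_cancel_iff) auto
      also have "\<dots> = ln 3 + ln x + ln y + ln z" using that by (simp add: ln_mult)
      finally show ?thesis .
    qed
    have qpos: "0 < q \<nu>" if "1 \<le> \<nu>" for \<nu> using q_ge_1[OF that] by linarith
    define Y0 where "Y0 = ln (q (Suc (n i)))"
    define m where "m = n (Suc (i + k))"
    define Y where "Y = ln (q (Suc m))"
    have D0: "0 \<le> D" using b(1) by (simp add: D_def)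
    have "D \<le> ln 3 + Y0 + ln (\<xi> (n i - 1)) + ln (\<xi> (n i))"
      unfolding D_def Y0_def using n_ge1(1,5)[of 0]
      by (intro ln_prod[OF b(2)] qpos xi_pos) auto
    moreover have "\<gamma> * Y0 - C \<le> - ln (\<xi> (n i))"
      unfolding Y0_def using n_ge1(3)[of 0] by (intro C(3)[rule_format]) simp
    ultimately have "D \<le> ln 3 + 2 * C + (1 - \<gamma>) * Y0 - \<gamma> * X 0"
      using x_ge[of 0] by (simp add: algebra_simps)
    then have "D / \<gamma> \<le> (ln 3 + 2 * C) / \<gamma> + t * Y0 - X 0" by (rule scale)
    moreover have "t * Y0 \<le> t * (g * X 0 + C / \<gamma>)"
      using growth[of "n i"] n_ge1(3,4)[of 0] t by (intro mult_left_mono) (auto simp: Y0_def X_def)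
    ultimately have low: "D / \<gamma> \<le> (h - 1) * X 0 + C1"
      by (simp add: C1_def h_def algebra_simps add_divide_distrib)
    have C1_ge: "(ln 3 + 2 * C) / \<gamma> \<le> C1" using t C(1) \<gamma>(1) by (simp add: C1_def divide_right_mono)
    have "X j + (D / \<gamma> - C1) \<le> t * X (Suc j)" if "j \<le> k" for j
    proof -
      have "D \<le> ln 3 + X (Suc j) + ln (\<xi> (n (i + j) - 1)) + ln (\<xi> (n (i + Suc j) - 1))"
        unfolding D_def X_def using n_ge1(1,5)[of j] n_ge1(1,5)[of "Suc j"] b(3)[rule_format, OF that]
        by (intro ln_prod qpos xi_pos) auto
      then have "D \<le> ln 3 + 2 * C + (1 - \<gamma>) * X (Suc j) - \<gamma> * X j"
        using x_ge[of j] x_ge[of "Suc j"] by (simp add: algebra_simps)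
      then have "D / \<gamma> \<le> (ln 3 + 2 * C) / \<gamma> + t * X (Suc j) - X j" by (rule scale)
      with C1_ge show ?thesis by linarith
    qed
    then have mid: "X 0 + S * (D / \<gamma> - C1) \<le> t ^ Suc k * X (Suc k)"
      unfolding S_def t_def using t by (intro S_sum_descent) (auto simp: t_def)
    have Xm: "X (Suc k) = ln (q m)" by (simp add: X_def m_def)
    have m1: "1 \<le> m" "N1 \<le> m" "N2 \<le> m" using n_ge1(3,4,5)[of "Suc k"] by (simp_all add: m_def)
    have "ln (q m) \<le> ln (2 * (b * \<xi> m * q (Suc m)))"
      using b(1,4) qpos[of m] qpos[of "Suc m"] xi_pos[of m] m1
      by (subst ln_le_cancel_iff) (auto simp: m_def)
    also have "\<dots> = ln 2 + D + ln (\<xi> m) + Y"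
      using b(1) qpos[of "Suc m"] xi_pos[of m] m1
      by (simp add: ln_mult D_def Y_def)
    finally have "X (Suc k) \<le> ln 2 + D + ln (\<xi> m) + Y" unfolding Xm .
    moreover have "\<gamma> * Y - C \<le> - ln (\<xi> m)" unfolding Y_def using C(3) m1(2) by blast
    moreover have "(1 - \<gamma>) * Y = Y - \<gamma> * Y" by (simp add: algebra_simps)
    \<comment> \<open>\<open>ln 2\<close> is enlarged to \<open>ln 3\<close> so that
      \<open>C1\<close> covers this error too.\<close>
    ultimately have "X (Suc k) \<le> ln 3 + C + D + (1 - \<gamma>) * Y" using ln3 by linarith
    then have "X (Suc k) / \<gamma> \<le> (ln 3 + C) / \<gamma> + D / \<gamma> + t * Y"
      using scale[of "X (Suc k)" "ln 3 + C + D" Y 0] by (simp add: add_divide_distrib)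
    moreover have "t * Y \<le> t * (g * X (Suc k) + C / \<gamma>)"
      unfolding Y_def Xm using growth[OF m1(2,3)] t by (intro mult_left_mono) auto
    moreover have "X (Suc k) / \<gamma> = (1 + t) * X (Suc k)" by (simp add: t_alt(1))
    moreover have "(ln 3 + C) / \<gamma> + t * (C / \<gamma>) \<le> C1"
      using C(1) \<gamma>(1) by (simp add: C1_def field_simps)
    ultimately have top: "(1 + t - h) * X (Suc k) \<le> D / \<gamma> + C1"
      by (simp add: h_def algebra_simps)
    show ?thesis
      using X_ge[of 0] X_ge[of "Suc k"] D0 \<gamma>(1) low top mid
      by (intro exI[of _ "X 0"] exI[of _ "X (Suc k)"] exI[of _ "D / \<gamma>"]) auto
  qed
  \<comment> \<open>\<open>E\<close> is nonnegative because \<open>b \<ge> 1\<close>, while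
    \<open>X0\<close> is unbounded.\<close>
  have "1 - h \<le> 0"
  proof (rule nonpos_if_bounded_multiples[where K = C1])
    fix M
    obtain X0 E where "M \<le> X0" "0 \<le> E" "E \<le> (h - 1) * X0 + C1" using occ by blast
    then show "\<exists>X\<ge>M. (1 - h) * X \<le> C1" by (intro exI[of _ X0]) (simp add: algebra_simps)
  qed
  then have h: "0 \<le> h - 1" by simp
  \<comment> \<open>The nonnegative weights \<open>1 + (h - 1) * S\<close> and \<open>h - 1\<close>
    on the last two inequalities eliminate \<open>E\<close> and \<open>X0\<close>. The remaining
    coefficient of \<open>X\<close> is minus
    \<open>theta \<gamma> * R_poly k g \<gamma>\<close>.\<close>
  have "(1 + t - h) * (1 + (h - 1) * S) - (h - 1) * t ^ Suc k \<le> 0"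
  proof (rule nonpos_if_bounded_multiples[where K = "2 * C1 * (1 + (h - 1) * S)"])
    fix M
    obtain X0 X E where X: "M \<le> X" "E \<le> (h - 1) * X0 + C1" "(1 + t - h) * X \<le> E + C1"
      "X0 + S * (E - C1) \<le> t ^ Suc k * X"
      using occ[of M] by blast
    have pos: "0 \<le> 1 + (h - 1) * S" using h S by simp
    have "(1 + t - h) * X * (1 + (h - 1) * S) \<le> (E + C1) * (1 + (h - 1) * S)"
      using X(3) pos by (rule mult_right_mono)
    moreover have "(h - 1) * (X0 + S * (E - C1)) \<le> (h - 1) * (t ^ Suc k * X)"
      using X(4) h by (rule mult_left_mono)
    ultimately have "((1 + t - h) * (1 + (h - 1) * S) - (h - 1) * t ^ Suc k) * X \<le> 2 * C1 * (1 + (h - 1) * S)"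
      using X(2) by (simp add: algebra_simps)
    with X(1) show "\<exists>X\<ge>M. ((1 + t - h) * (1 + (h - 1) * S) - (h - 1) * t ^ Suc k) * X
        \<le> 2 * C1 * (1 + (h - 1) * S)" by blast
  qed
  then have "0 \<le> theta \<gamma> * R_poly k g \<gamma>"
    unfolding theta_mult_R_poly'[OF \<gamma>(1) k] by (simp add: h_def t_def S_def)
  then have "0 \<le> R_poly k g \<gamma>" using t by (simp add: t_def zero_le_mult_iff)
  with h show ?thesis by (simp add: h_def t_def g_def)
qed

lemma R_poly_nonneg:
  assumes l: "omega_hat \<alpha> = ereal l" "l < 1" and w: "omega \<alpha> = ereal w"
    and k: "1 \<le> k" and inf: "infinite {i. AjB_occurs_at (pattern_word \<alpha>) k i}"
  shows "1 \<le> theta l * (w / l)" "0 \<le> R_poly k (w / l) l"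
proof -
  have l0: "0 < l" using omega_hat_pos l by simp
  \<comment> \<open>\<open>L\<close> tends to \<open>l\<close> from strictly below, starting at
    \<open>l / 2\<close> and hence positive; \<open>W\<close> tends to \<open>w\<close> from
    strictly above.\<close>
  define L where "L m = l - l * inverse (real (Suc (Suc m)))" for m
  define W where "W m = w + inverse (real (Suc m))" for m
  have L: "L \<longlonglongrightarrow> l"
    using tendsto_diff[OF tendsto_const tendsto_mult[OF tendsto_const
          LIMSEQ_Suc[OF LIMSEQ_inverse_real_of_nat]], of l l]
    by (simp add: L_def[abs_def])
  have W: "W \<longlonglongrightarrow> w"
    using tendsto_add[OF tendsto_const LIMSEQ_inverse_real_of_nat, of w] by (simp add: W_def[abs_def])
  have L_bounds: "0 < L m" "L m < l" for m
    using l0 by (auto simp: L_def field_simps intro: add_pos_nonneg)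
  have W_gt: "w < W m" for m by (simp add: W_def)
  have *: "1 \<le> theta (L m) * (W m / L m) \<and> 0 \<le> R_poly k (W m / L m) (L m)" for m
    using L_bounds[of m] W_gt[of m] l w by (intro R_poly_nonneg_approx k inf) auto
  have th: "(\<lambda>m. theta (L m)) \<longlonglongrightarrow> theta l"
    unfolding theta_def using L l0 by (auto intro!: tendsto_intros)
  have WL: "(\<lambda>m. W m / L m) \<longlonglongrightarrow> w / l" using L W l0 by (auto intro!: tendsto_intros)
  have S: "(\<lambda>m. S_sum j (L m)) \<longlonglongrightarrow> S_sum j l" for j
    unfolding S_sum_def by (intro tendsto_intros th)
  have "(\<lambda>m. theta (L m) * (W m / L m)) \<longlonglongrightarrow> theta l * (w / l)" by (intro tendsto_mult th WL)
  then show "1 \<le> theta l * (w / l)" by (rule LIMSEQ_le_const) (use * in blast)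
  have "(\<lambda>m. R_poly k (W m / L m) (L m)) \<longlonglongrightarrow> R_poly k (w / l) l"
    unfolding R_poly_def M_coeff_def N_coeff_def P_coeff_def
    using l0 by (intro tendsto_intros th WL S L) auto
  then show "0 \<le> R_poly k (w / l) l" by (rule LIMSEQ_le_const) (use * in blast)
qed

end

section \<open>From the supremum \<open>pattern_k\<close> to the two cases of the theorem\<close>

lemma less_pattern_k:
  assumes "enat K < pattern_k \<alpha>"
  shows "\<exists>j>K. infinite {i. AjB_occurs_at (pattern_word \<alpha>) j i} \<and> enat j \<le> pattern_k \<alpha>"
proof -
  obtain j where "infinite {i. AjB_occurs_at (pattern_word \<alpha>) j i}" "K < j"
    using assms by (auto simp: pattern_k_def less_SUP_iff)
  then show ?thesis by (auto simp: pattern_k_def intro!: exI[of _ j] SUP_upper)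
qed

theorem theorem1:
  fixes \<alpha> :: "real^3"
  assumes "lin_indep_over_rat \<alpha>"
    and "ereal (1 / 3) < omega_hat \<alpha>" and "omega_hat \<alpha> < 1"
  shows "(\<forall>k::nat. 1 \<le> k \<and> pattern_k \<alpha> = enat k \<longrightarrow>
            omega \<alpha> / omega_hat \<alpha> \<ge> ereal (g_root k (real_of_ereal (omega_hat \<alpha>)))) \<and>
         (pattern_k \<alpha> = \<infinity> \<longrightarrow>
            omega \<alpha> / omega_hat \<alpha> \<ge> ereal (g_bar (real_of_ereal (omega_hat \<alpha>))))"
proof -
  obtain l where l: "omega_hat \<alpha> = ereal l" "1 / 3 < l" "l < 1"
    using assms(2,3) by (cases "omega_hat \<alpha>") (auto simp: one_ereal_def)
  show ?thesis
  proof (cases "omega \<alpha> = \<infinity>")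
    case True
    then show ?thesis using l by simp
  next
    case False
    then obtain w where w: "omega \<alpha> = ereal w" "l \<le> w"
      using omega_hat_le_omega[of \<alpha>] l(1) by (cases "omega \<alpha>") auto
    interpret approximable_point \<alpha>
      by unfold_locales (use assms(1) l in \<open>auto simp: zero_ereal_def\<close>)
    have ratio: "omega \<alpha> / omega_hat \<alpha> = ereal (w / l)" using l w by simp
    have ge1: "1 \<le> w / l" using w(2) l(2) by simp
    note R = R_poly_nonneg[OF l(1,3) w(1)]
    have "g_root k l \<le> w / l" if k: "1 \<le> k" "pattern_k \<alpha> = enat k" for k
    proof -
      \<comment> \<open>A finite supremum \<open>k \<ge> 1\<close> is attained: an exponent above
        \<open>k - 1\<close> and at most \<open>k\<close> equals \<open>k\<close>.\<close>
      have "enat (k - 1) < pattern_k \<alpha>" using k by simp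
      then obtain j where "k - 1 < j" "infinite {i. AjB_occurs_at (pattern_word \<alpha>) j i}" "j \<le> k"
        using less_pattern_k[of "k - 1" \<alpha>] k(2) by auto
      moreover from this k have "j = k" by linarith
      ultimately show ?thesis using R(2)[OF k(1)] l ge1 k(1) by (intro g_root_le) auto
    qed
    moreover have "g_bar l \<le> w / l" if "pattern_k \<alpha> = \<infinity>"
    proof -
      \<comment> \<open>An infinite supremum yields arbitrarily large exponents, as the limit in
        \<open>g_bar_le\<close> requires.\<close>
      have ex: "\<exists>k\<ge>K. 1 \<le> k \<and> infinite {i. AjB_occurs_at (pattern_word \<alpha>) k i}" for K
        using less_pattern_k[of K \<alpha>] that by (auto intro: less_imp_le)
      then have "1 \<le> theta l * (w / l)" using R(1) by blast
      moreover have "\<exists>k\<ge>K. 1 \<le> k \<and> 0 \<le> R_poly k (w / l) l" for K using ex[of K] R(2) by blast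
      ultimately show ?thesis using l by (intro g_bar_le) auto
    qed
    ultimately show ?thesis by (simp add: l(1) ratio[unfolded l(1)])
  qed
qed

end
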